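(* Let $S$ be an inverse semigroup with zero and let $K$ be a commutative ring with unit. Let $I$ be the singular ideal of the contracted semigroup algebra $K_0S$, let $\mathcal G_T(S)$ be the tight groupoid of $S$, let $I_K(\mathcal G_T(S))$ be the ideal of singular functions of the Steinberg algebra $K\mathcal G_T(S)$, and let $\Psi:K_0S\to K\mathcal G_T(S)$ be the canonical surjective homomorphism, given on $0\neq s\in S$ by $\Psi(s)=\chi_{(s,\,D(s^*s)\cap\widehat{E(S)}_T)}$. Then $I=\Psi^{-1}(I_K(\mathcal G_T(S)))$.
   Context: An inverse semigroup is a semigroup $S$ in which every $s$ has a unique $s^*$ with $ss^*s=s$, $s^*ss^*=s^*$; $E(S)$ is its semilattice of idempotents, and $s\le t$ means $s=ts^*s$. $K_0S$ is the $K$-algebra with basis $S\setminus\{0\}$ and multiplication extending that of $S$ (zero of $S$ identified with $0$). An element $a\in K_0S$ is singular if for every $0\neq e\in E(S)$ there is $0\neq f\in E(S)$, $f\le e$, with $af=0$; the singular elements form a two-sided ideal, the singular ideal. Tight groupoid. A character of $E(S)$ is a non-zero, zero-preserving homomorphism $\theta:E(S)\to\{0,1\}$; the set $\widehat{E(S)}$ of characters has the topology of pointwise convergence, and $D(e)=\{\theta:\theta(e)=1\}$. Elements $e_1,\dots,e_n\le e$ cover $e$ if for every $0\ne f\le e$ some $fe_i\ne0$. A character $\theta$ is tight if whenever $e_1,\dots,e_n$ cover $e$ and $\theta(e)=1$, some $\theta(e_i)=1$; $\widehat{E(S)}_T$ is the subspace of tight characters. $S$ acts by partial homeomorphisms $\beta_s:D(s^*s)\to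 D(ss^* )$, $\beta_s(\theta)(e)=\theta(s^*es)$. The universal groupoid $\mathcal G(S)$ has arrows the classes $[s,\theta]$ of pairs with $\theta\in D(s^*s)$, where $(s,\theta)\sim(t,\theta')$ iff $\theta=\theta'$ and there is $u\le s,t$ with $\theta\in D(u^*u)$; $d[s,\theta]=\theta$, $r[s,\theta]=\beta_s(\theta)$, $[s,\beta_t(\theta)][t,\theta]=[st,\theta]$, with basis of open sets $(s,U)=\{[s,\theta]:\theta\in U\}$, $U\subseteq D(s^*s)$ open. The tight groupoid $\mathcal G_T(S)$ is the restriction of $\mathcal G(S)$ to the closed invariant subspace $\widehat{E(S)}_T$; for $U\subseteq D(s^*s)\cap\widehat{E(S)}_T$ we write $(s,U)=\{[s,\theta]:\theta\in U\}$. It is an ample groupoid. For an ample groupoid $\mathcal G$, the Steinberg algebra $K\mathcal G$ is the $K$-span in $K^{\mathcal G}$ of the characteristic functions $\chi_U$ of compact local bisections (open $U\subseteq\mathcal G$, compact, on which $d$ and $r$ restrict to homeomorphisms onto their images) with convolution $(f*g)(\gamma)=\sum_{\alpha\beta=\gamma}f(\alpha)g(\beta)$. A function $f\in K\mathcal G$ is singular if $f^{-1}(K\setminus\{0\})$ has empty interior; $I_K(\mathcal G)$ denotes the ideal of singular functions. The map $\Psi$ is the composition of the isomorphism $K_0S\to K\mathcal G(S)$, $s\mapsto\chi_{(s,D(s^*s))}$, with restriction of functions to $\mathcal G_T(S)$. *)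

theory Defs
  imports "HOL-Analysis.Analysis"
begin

section \<open>Inverse semigroups with zero\<close>

class inverse_semigroup_zero = semigroup_mult + mult_zero +
  assumes ex1_star: "\<exists>!t. s * t * s = s \<and> t * s * t = t"

definition star :: "'s::inverse_semigroup_zero \<Rightarrow> 's" where
  "star s = (THE t. s * t * s = s \<and> t * s * t = t)"

definition idempotents :: "'s::inverse_semigroup_zero set" where
  "idempotents = {e. e * e = e}"

definition nat_le :: "'s::inverse_semigroup_zero \<Rightarrow> 's \<Rightarrow> bool" where
  "nat_le s t \<longleftrightarrow> s = t * star s * s"

section \<open>The contracted semigroup algebra\<close>

text \<open>The sort \<open>{comm_ring, comm_monoid_mult}\<close> describes commutative unital rings, the zero ring
  included (unlike \<open>comm_ring_1\<close>). An element of the algebra is given by its coordinates with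
  respect to the basis of nonzero elements of the semigroup; the coordinate at \<open>0\<close> is \<open>0\<close> by
  convention.\<close>

definition contracted_algebra ::
    "('s::inverse_semigroup_zero \<Rightarrow> 'k::{comm_ring, comm_monoid_mult}) set" where
  "contracted_algebra = {a. finite {s. a s \<noteq> 0} \<and> a 0 = 0}"

definition contracted_mult ::
    "('s::inverse_semigroup_zero \<Rightarrow> 'k::{comm_ring, comm_monoid_mult}) \<Rightarrow> ('s \<Rightarrow> 'k) \<Rightarrow> 's \<Rightarrow> 'k" where
  "contracted_mult a b u =
     (if u = 0 then 0 else \<Sum>(s, t)\<in>{(s, t). a s \<noteq> 0 \<and> b t \<noteq> 0 \<and> s * t = u}. a s * b t)"

definition contracted_of ::
    "'s::inverse_semigroup_zero \<Rightarrow> 's \<Rightarrow> 'k::{comm_ring, comm_monoid_mult}" where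
  "contracted_of s = (\<lambda>t. if t = s \<and> s \<noteq> 0 then 1 else 0)"

definition singular_ideal ::
    "('s::inverse_semigroup_zero \<Rightarrow> 'k::{comm_ring, comm_monoid_mult}) set" where
  "singular_ideal = {a \<in> contracted_algebra.
     \<forall>e\<in>idempotents. e \<noteq> 0 \<longrightarrow>
       (\<exists>f\<in>idempotents. f \<noteq> 0 \<and> nat_le f e \<and> contracted_mult a (contracted_of f) = (\<lambda>_. 0))}"

section \<open>Topological groupoids and their Steinberg algebras\<close>

text \<open>The objects and the arrows are the points of \<open>units\<close> and of \<open>arrows\<close>;
  \<open>gcomp G \<alpha> \<beta>\<close> is meaningful only if \<open>gdom G \<alpha> = gran G \<beta>\<close>.\<close>

record ('o, 'g) top_groupoid =
  units :: "'o topology"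
  arrows :: "'g topology"
  gdom :: "'g \<Rightarrow> 'o"
  gran :: "'g \<Rightarrow> 'o"
  gcomp :: "'g \<Rightarrow> 'g \<Rightarrow> 'g"

definition groupoid_restrict :: "('o, 'g) top_groupoid \<Rightarrow> 'o set \<Rightarrow> ('o, 'g) top_groupoid" where
  "groupoid_restrict G X =
     \<lparr>units = subtopology (units G) X,
      arrows = subtopology (arrows G) {\<gamma>. gdom G \<gamma> \<in> X \<and> gran G \<gamma> \<in> X},
      gdom = gdom G, gran = gran G, gcomp = gcomp G\<rparr>"

definition compact_local_bisection :: "('o, 'g) top_groupoid \<Rightarrow> 'g set \<Rightarrow> bool" where
  "compact_local_bisection G U \<longleftrightarrow>
     openin (arrows G) U \<and> compactin (arrows G) U \<and>
     homeomorphic_map (subtopology (arrows G) U) (subtopology (units G) (gdom G ` U)) (gdom G) \<and>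
     homeomorphic_map (subtopology (arrows G) U) (subtopology (units G) (gran G ` U)) (gran G)"

definition char_fun :: "'g set \<Rightarrow> 'g \<Rightarrow> 'k::{comm_ring, comm_monoid_mult}" where
  "char_fun U \<gamma> = (if \<gamma> \<in> U then 1 else 0)"

text \<open>Functions on \<open>G\<close> are functions on the whole arrow type vanishing off
  \<open>topspace (arrows G)\<close>, which holds automatically in the span below.\<close>

definition steinberg_algebra ::
    "('o, 'g) top_groupoid \<Rightarrow> ('g \<Rightarrow> 'k::{comm_ring, comm_monoid_mult}) set" where
  "steinberg_algebra G =
     {(\<lambda>\<gamma>. \<Sum>U\<in>\<U>. c U * char_fun U \<gamma>) | \<U> c. finite \<U> \<and> (\<forall>U\<in>\<U>. compact_local_bisection G U)}"

text \<open>The sum has finitely many terms when \<open>f\<close> and \<open>g\<close> lie in the Steinberg algebra. The product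
  does not enter the definition of the set of singular functions.\<close>

definition steinberg_mult ::
    "('o, 'g) top_groupoid \<Rightarrow> ('g \<Rightarrow> 'k::{comm_ring, comm_monoid_mult}) \<Rightarrow> ('g \<Rightarrow> 'k) \<Rightarrow> 'g \<Rightarrow> 'k" where
  "steinberg_mult G f g \<gamma> =
     (\<Sum>(\<alpha>, \<beta>)\<in>{(\<alpha>, \<beta>). \<alpha> \<in> topspace (arrows G) \<and> \<beta> \<in> topspace (arrows G) \<and>
         gdom G \<alpha> = gran G \<beta> \<and> gcomp G \<alpha> \<beta> = \<gamma> \<and> f \<alpha> \<noteq> 0 \<and> g \<beta> \<noteq> 0}. f \<alpha> * g \<beta>)"

definition singular_functions ::
    "('o, 'g) top_groupoid \<Rightarrow> ('g \<Rightarrow> 'k::{comm_ring, comm_monoid_mult}) set" where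
  "singular_functions G = {f \<in> steinberg_algebra G.
     (arrows G) interior_of {\<gamma> \<in> topspace (arrows G). f \<gamma> \<noteq> 0} = {}}"

section \<open>Characters\<close>

text \<open>The values \<open>0, 1\<close> are \<open>False, True\<close>, with conjunction as product. Functions on the set of
  idempotents are extensional, so that the topology of pointwise convergence is induced by
  \<open>product_topology\<close>.\<close>

definition characters :: "('s::inverse_semigroup_zero \<Rightarrow> bool) set" where
  "characters = {\<theta> \<in> extensional idempotents.
     (\<forall>e\<in>idempotents. \<forall>f\<in>idempotents. \<theta> (e * f) \<longleftrightarrow> \<theta> e \<and> \<theta> f) \<and>
     \<not> \<theta> 0 \<and> (\<exists>e\<in>idempotents. \<theta> e)}"

definition character_space :: "('s::inverse_semigroup_zero \<Rightarrow> bool) topology" where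
  "character_space =
     subtopology (product_topology (\<lambda>_. discrete_topology UNIV) idempotents) characters"

definition char_dom :: "'s::inverse_semigroup_zero \<Rightarrow> ('s \<Rightarrow> bool) set" where
  "char_dom e = {\<theta> \<in> characters. \<theta> e}"

definition covers :: "'s::inverse_semigroup_zero set \<Rightarrow> 's \<Rightarrow> bool" where
  "covers F e \<longleftrightarrow> finite F \<and> F \<subseteq> idempotents \<and> (\<forall>g\<in>F. nat_le g e) \<and>
     (\<forall>f\<in>idempotents. f \<noteq> 0 \<and> nat_le f e \<longrightarrow> (\<exists>g\<in>F. f * g \<noteq> 0))"

text \<open>The empty set covers only \<open>0\<close>, so admitting it imposes no condition on a character.\<close>

definition tight_characters :: "('s::inverse_semigroup_zero \<Rightarrow> bool) set" where
  "tight_characters = {\<theta> \<in> characters.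
     \<forall>e\<in>idempotents. \<forall>F. covers F e \<and> \<theta> e \<longrightarrow> (\<exists>g\<in>F. \<theta> g)}"

definition act :: "'s::inverse_semigroup_zero \<Rightarrow> ('s \<Rightarrow> bool) \<Rightarrow> 's \<Rightarrow> bool" where
  "act s \<theta> = (\<lambda>e\<in>idempotents. \<theta> (star s * e * s))"

section \<open>The universal groupoid and the tight groupoid\<close>

type_synonym 's germ_class = "('s \<times> ('s \<Rightarrow> bool)) set"

definition germ_rel ::
    "(('s::inverse_semigroup_zero \<times> ('s \<Rightarrow> bool)) \<times> ('s \<times> ('s \<Rightarrow> bool))) set" where
  "germ_rel = {((s, \<theta>), (t, \<theta>')). \<theta> \<in> char_dom (star s * s) \<and> \<theta>' \<in> char_dom (star t * t) \<and>
     \<theta> = \<theta>' \<and> (\<exists>u. nat_le u s \<and> nat_le u t \<and> \<theta> \<in> char_dom (star u * u))}"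

definition germ :: "'s::inverse_semigroup_zero \<Rightarrow> ('s \<Rightarrow> bool) \<Rightarrow> 's germ_class" where
  "germ s \<theta> = germ_rel `` {(s, \<theta>)}"

definition germ_set :: "'s::inverse_semigroup_zero \<Rightarrow> ('s \<Rightarrow> bool) set \<Rightarrow> 's germ_class set" where
  "germ_set s U = {germ s \<theta> | \<theta>. \<theta> \<in> U}"

text \<open>The sets passed to \<open>the_elem\<close> are singletons since the structure maps do not depend on the
  representatives. The sets generating the arrow topology form a basis of it, and their union is the set of
  all germs.\<close>

definition universal_groupoid ::
    "('s::inverse_semigroup_zero \<Rightarrow> bool, 's germ_class) top_groupoid" where
  "universal_groupoid =
     \<lparr>units = character_space,
      arrows = topology_generated_by
        {germ_set s U | s U. openin character_space U \<and> U \<subseteq> char_dom (star s * s)},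
      gdom = (\<lambda>\<gamma>. the_elem {\<theta>. \<exists>s. (s, \<theta>) \<in> \<gamma>}),
      gran = (\<lambda>\<gamma>. the_elem {act s \<theta> | s \<theta>. (s, \<theta>) \<in> \<gamma>}),
      gcomp = (\<lambda>\<gamma> \<delta>. the_elem {germ (s * t) \<theta> | s t \<theta>. (s, act t \<theta>) \<in> \<gamma> \<and> (t, \<theta>) \<in> \<delta>})\<rparr>"

definition tight_groupoid ::
    "('s::inverse_semigroup_zero \<Rightarrow> bool, 's germ_class) top_groupoid" where
  "tight_groupoid = groupoid_restrict universal_groupoid tight_characters"

text \<open>The linear extension of \<open>s \<mapsto> \<chi>\<^bsub>(s, D(s\<^sup>*s) \<inter> T)\<^esub>\<close>, with \<open>T\<close> the set of tight characters.\<close>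

definition Psi ::
    "('s::inverse_semigroup_zero \<Rightarrow> 'k::{comm_ring, comm_monoid_mult}) \<Rightarrow> 's germ_class \<Rightarrow> 'k" where
  "Psi a = (\<lambda>\<gamma>. \<Sum>s\<in>{s. a s \<noteq> 0}.
     a s * char_fun (germ_set s (char_dom (star s * s) \<inter> tight_characters)) \<gamma>)"

end

theory Submission
  imports Defs
begin

text \<open>If \<open>\<theta>(f) = 1\<close>, then \<open>Psi (a f)\<close> and \<open>Psi a\<close> agree at every germ \<open>[s, \<theta>]\<close>. Every nonempty open set of
  germs contains all \<open>[s, \<theta>]\<close> with \<open>\<theta>\<close> tight and \<open>\<theta>(e) = 1\<close>, for some \<open>s\<close> and some idempotent
  \<open>0 \<noteq> e \<le> s\<^sup>*s\<close>; if \<open>a f = 0\<close> with \<open>0 \<noteq> f \<le> e\<close>, then \<open>Psi a\<close> vanishes at those with \<open>\<theta>(f) = 1\<close>, and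
  such \<open>\<theta>\<close> exist because maximal filters are tight. Conversely, below any \<open>e\<close> there is an \<open>f\<close> such
  that distinct elements in the support of \<open>a f\<close> have disjoint sets of germs, so a nonzero
  coefficient of \<open>a f\<close> makes \<open>Psi a\<close> nonzero on a nonempty open set.\<close>

section \<open>Inverse semigroups\<close>

lemma mult_star_mult: "s * star s * s = s"
  and star_mult_star: "star s * s * star s = star s"
  for s :: "'s::inverse_semigroup_zero"
  using theI'[OF ex1_star[of s]] unfolding star_def by auto

lemma star_unique: "s * t * s = s \<Longrightarrow> t * s * t = t \<Longrightarrow> star s = t"
  for s :: "'s::inverse_semigroup_zero"
  using ex1_star[of s] mult_star_mult star_mult_star by metis

lemma star_star: "star (star s) = s" for s :: "'s::inverse_semigroup_zero"
  by (rule star_unique) (rule star_mult_star mult_star_mult)+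

lemma idempotents_iff: "e \<in> idempotents \<longleftrightarrow> e * e = e"
  by (simp add: idempotents_def)

lemma star_idempotent: "e \<in> idempotents \<Longrightarrow> star e = e"
  by (rule star_unique) (simp_all add: idempotents_iff)

lemma zero_idempotent: "0 \<in> idempotents"
  by (simp add: idempotents_iff)

lemma star_mult_idempotent: "star s * s \<in> idempotents"
  and mult_star_idempotent: "s * star s \<in> idempotents"
  for s :: "'s::inverse_semigroup_zero"
  by (metis idempotents_iff mult.assoc mult_star_mult)+

text \<open>If \<open>x\<close> is the inverse of \<open>e * f\<close>, then
  \<open>f * x * e\<close> is an inverse of \<open>e * f\<close> as well, so
  \<open>x = f * x * e\<close> by uniqueness. This form makes \<open>x\<close> idempotent, hence its
  own inverse, while the inverse of \<open>x\<close> is \<open>e * f\<close>.\<close>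

lemma idempotent_mult:
  fixes e f :: "'s::inverse_semigroup_zero"
  assumes "e \<in> idempotents" "f \<in> idempotents"
  shows "e * f \<in> idempotents"
proof -
  define x where "x = star (e * f)"
  have e: "e * e = e" and f: "f * f = f"
    using assms by (auto simp: idempotents_iff)
  have 1: "(e * f) * x * (e * f) = e * f" and 2: "x * (e * f) * x = x"
    unfolding x_def by (rule mult_star_mult star_mult_star)+
  have "(e * f) * (f * x * e) * (e * f) = e * (f * f) * x * (e * e) * f"
    by (simp only: mult.assoc)
  also have "\<dots> = e * f"
    using 1 e f by (simp add: mult.assoc)
  finally have 3: "(e * f) * (f * x * e) * (e * f) = e * f" .
  have "(f * x * e) * (e * f) * (f * x * e) = f * x * (e * e) * (f * f) * x * e"
    by (simp only: mult.assoc)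
  also have "\<dots> = f * (x * (e * f) * x) * e"
    using e f by (simp add: mult.assoc)
  finally have 4: "(f * x * e) * (e * f) * (f * x * e) = f * x * e"
    using 2 by simp
  have x: "x = f * x * e"
    using star_unique[OF 3 4] by (simp add: x_def)
  have "x * x = f * (x * (e * f) * x) * e"
    by (subst x, subst (2) x) (simp only: mult.assoc)
  then have "x \<in> idempotents"
    using 2 x by (simp add: idempotents_iff)
  then have "x = star x"
    by (simp add: star_idempotent)
  also have "\<dots> = e * f"
    by (simp add: x_def star_star)
  finally show ?thesis
    using \<open>x \<in> idempotents\<close> by simp
qed

text \<open>Since \<open>e * f\<close> and \<open>f * e\<close> are idempotent, \<open>f * e\<close>
  is an inverse of \<open>e * f\<close>; but so is \<open>e * f\<close> itself.\<close>

lemma idempotent_commute: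
  fixes e f :: "'s::inverse_semigroup_zero"
  assumes "e \<in> idempotents" "f \<in> idempotents"
  shows "e * f = f * e"
proof -
  have *: "x * y * (y * x) * (x * y) = x * y"
    if "x \<in> idempotents" "y \<in> idempotents" for x y :: 's
  proof -
    have "x * y * (y * x) * (x * y) = x * (y * y) * (x * x) * y"
      by (simp only: mult.assoc)
    also have "\<dots> = (x * y) * (x * y)"
      using that by (simp add: idempotents_iff mult.assoc)
    also have "\<dots> = x * y"
      using idempotent_mult[OF that] by (simp add: idempotents_iff)
    finally show ?thesis .
  qed
  have "star (e * f) = f * e"
    by (rule star_unique) (use * assms in blast)+
  then show ?thesis
    using star_idempotent[OF idempotent_mult[OF assms]] by simp
qed

lemma star_mult: "star (s * t) = star t * star s" for s :: "'s::inverse_semigroup_zero"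
proof (rule star_unique)
  have c: "(star s * s) * (t * star t) = (t * star t) * (star s * s)"
    by (intro idempotent_commute star_mult_idempotent mult_star_idempotent)
  have "s * t * (star t * star s) * (s * t) = s * ((t * star t) * (star s * s)) * t"
    by (simp only: mult.assoc)
  also have "\<dots> = (s * star s * s) * (t * star t * t)"
    unfolding c[symmetric] by (simp only: mult.assoc)
  finally show "s * t * (star t * star s) * (s * t) = s * t"
    by (simp add: mult_star_mult)
  have "star t * star s * (s * t) * (star t * star s) =
      star t * ((star s * s) * (t * star t)) * star s"
    by (simp only: mult.assoc)
  also have "\<dots> = (star t * t * star t) * (star s * s * star s)"
    unfolding c by (simp only: mult.assoc)
  finally show "star t * star s * (s * t) * (star t * star s) = star t * star s"
    by (simp add: star_mult_star)
qed

section \<open>Conjugation of idempotents\<close>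

lemma mult_idempotent_left_commute:
  fixes s :: "'s::inverse_semigroup_zero"
  assumes "e \<in> idempotents"
  shows "s * star s * e * s = e * s"
proof -
  have "s * star s * e = e * (s * star s)"
    by (intro idempotent_commute mult_star_idempotent assms)
  then show ?thesis
    by (metis mult.assoc mult_star_mult)
qed

lemma idempotent_conj:
  fixes s :: "'s::inverse_semigroup_zero"
  assumes "e \<in> idempotents"
  shows "star s * e * s \<in> idempotents"
proof -
  have "star s * e * s * (star s * e * s) = star s * e * (s * star s * e * s)"
    by (simp only: mult.assoc)
  also have "\<dots> = star s * (e * e) * s"
    by (subst mult_idempotent_left_commute[OF assms]) (simp only: mult.assoc)
  finally show ?thesis
    using assms by (simp add: idempotents_iff)
qed

text \<open>The factor \<open>s * star s\<close> in the middle of the right-hand side is absorbed by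
  \<open>f * s\<close>. This is the multiplicativity behind \<open>act_character\<close>.\<close>

lemma conj_mult:
  fixes s :: "'s::inverse_semigroup_zero"
  assumes "f \<in> idempotents"
  shows "star s * (e * f) * s = (star s * e * s) * (star s * f * s)"
  using mult_idempotent_left_commute[OF assms, of s] by (metis mult.assoc)

lemma star_mult_mult_idempotent:
  fixes s :: "'s::inverse_semigroup_zero"
  assumes "p \<in> idempotents"
  shows "star (s * p) * (s * p) = (star s * s) * p"
proof -
  have "star (s * p) * (s * p) = p * (star s * s) * p"
    by (simp add: star_mult star_idempotent[OF assms] mult.assoc)
  also have "\<dots> = (star s * s) * (p * p)"
    using idempotent_commute[OF assms star_mult_idempotent] by (simp only: mult.assoc)
  finally show ?thesis
    using assms by (simp add: idempotents_iff)
qed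

section \<open>The natural partial order\<close>

lemma nat_le_eq: "nat_le s t \<Longrightarrow> s = t * (star s * s)"
  by (simp add: nat_le_def mult.assoc)

text \<open>Together with \<open>nat_le_eq\<close> this describes the elements below
  \<open>t\<close> as the products of \<open>t\<close> with idempotents on the right. Common lower
  bounds of semigroup elements are handled in this form when germs are compared.\<close>

lemma nat_le_mult_idempotent:
  fixes t :: "'s::inverse_semigroup_zero"
  assumes "p \<in> idempotents"
  shows "nat_le (t * p) t"
proof -
  have "t * star (t * p) * (t * p) = t * (star (t * p) * (t * p))"
    by (simp only: mult.assoc)
  also have "\<dots> = (t * star t * t) * p"
    by (simp only: star_mult_mult_idempotent[OF assms] mult.assoc)
  finally show ?thesis
    by (simp add: nat_le_def mult_star_mult)
qed

lemma nat_le_idempotent_iff: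
  assumes "f \<in> idempotents"
  shows "nat_le f e \<longleftrightarrow> f = e * f"
  using assms by (simp add: nat_le_def star_idempotent mult.assoc idempotents_iff)

lemma nat_le_refl: "nat_le s s"
  by (simp add: nat_le_def mult_star_mult)

lemma nat_le_domain:
  fixes s :: "'s::inverse_semigroup_zero"
  assumes "nat_le s t"
  shows "star s * s = (star t * t) * (star s * s)"
  using star_mult_mult_idempotent[OF star_mult_idempotent, of t s] nat_le_eq[OF assms, symmetric]
  by simp

lemma idempotent_nat_le_trans:
  assumes "f \<in> idempotents" "g \<in> idempotents" "nat_le f g" "nat_le g h"
  shows "nat_le f h"
  using assms by (metis mult.assoc nat_le_idempotent_iff)

section \<open>Tight characters\<close>

lemma character_mult:
  "\<theta> \<in> characters \<Longrightarrow> e \<in> idempotents \<Longrightarrow> f \<in> idempotents \<Longrightarrow> \<theta> (e * f) \<longleftrightarrow> \<theta> e \<and> \<theta> f"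
  by (simp add: characters_def)

lemma character_zero: "\<theta> \<in> characters \<Longrightarrow> \<not> \<theta> 0"
  by (simp add: characters_def)

lemma character_mono:
  assumes "\<theta> \<in> characters" "f \<in> idempotents" "e \<in> idempotents" "nat_le f e" "\<theta> f"
  shows "\<theta> e"
  using assms character_mult[of \<theta> e f] nat_le_idempotent_iff[of f e] by simp

text \<open>Starting from \<open>e\<^sub>0\<close> and multiplying by the members of
  \<open>A\<close> one after another keeps the value of \<theta> at 1, because \<theta> is
  multiplicative.\<close>

lemma character_lower_bound:
  assumes "\<theta> \<in> characters" "finite A" "A \<subseteq> idempotents" "\<forall>g\<in>A. \<theta> g"
    and "e\<^sub>0 \<in> idempotents" "\<theta> e\<^sub>0"
  obtains e where "e \<in> idempotents" "\<theta> e" "nat_le e e\<^sub>0" "\<forall>g\<in>A. nat_le e g"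
proof -
  have "\<exists>e\<in>idempotents. \<theta> e \<and> nat_le e e\<^sub>0 \<and> (\<forall>g\<in>A. nat_le e g)"
    using assms(2-4)
  proof (induction A rule: finite_induct)
    case empty
    then show ?case
      using assms nat_le_refl by blast
  next
    case (insert g A)
    then obtain e where e: "e \<in> idempotents" "\<theta> e" "nat_le e e\<^sub>0" "\<forall>g\<in>A. nat_le e g"
      by auto
    have g: "g \<in> idempotents" "\<theta> g"
      using insert.prems by auto
    have eg: "e * g \<in> idempotents" "\<theta> (e * g)" "nat_le (e * g) e"
      using e g assms(1) by (auto simp: character_mult idempotent_mult nat_le_mult_idempotent)
    have "nat_le (e * g) g"
      using nat_le_mult_idempotent[OF e(1), of g] idempotent_commute[OF e(1) g(1)] by simp
    then show ?case
      using e eg idempotent_nat_le_trans[OF eg(1) e(1) eg(3)] by blast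
  qed
  then show thesis
    using that by blast
qed

text \<open>Zorn's lemma is applied to the multiplicatively closed sets of idempotents that contain
  \<open>f\<close> and omit \<open>0\<close>. The last property expresses maximality; upward closure
  is derived from it in \<open>tight_character_exists\<close>.\<close>

lemma maximal_filter_exists:
  fixes f :: "'s::inverse_semigroup_zero"
  assumes "f \<in> idempotents" "f \<noteq> 0"
  obtains M where "M \<subseteq> idempotents" "f \<in> M" "0 \<notin> M" "\<And>x y. x \<in> M \<Longrightarrow> y \<in> M \<Longrightarrow> x * y \<in> M"
    "\<And>g. g \<in> idempotents \<Longrightarrow> \<forall>m\<in>M. m * g \<noteq> 0 \<Longrightarrow> g \<in> M"
proof -
  define \<A> where "\<A> = {A. A \<subseteq> idempotents \<and> f \<in> A \<and> 0 \<notin> A \<and> (\<forall>x\<in>A. \<forall>y\<in>A. x * y \<in> A)}"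
  have "\<exists>M\<in>\<A>. \<forall>X\<in>\<A>. M \<subseteq> X \<longrightarrow> X = M"
  proof (rule subset_Zorn_nonempty)
    have "{f} \<in> \<A>"
      using assms by (auto simp: \<A>_def idempotents_iff)
    then show "\<A> \<noteq> {}"
      by blast
    fix \<C> assume \<C>: "\<C> \<noteq> {}" "subset.chain \<A> \<C>"
    have "x * y \<in> \<Union>\<C>" if xy: "x \<in> \<Union>\<C>" "y \<in> \<Union>\<C>" for x y
    proof -
      obtain A B where AB: "x \<in> A" "A \<in> \<C>" "y \<in> B" "B \<in> \<C>"
        using xy by blast
      then have "A \<subseteq> B \<or> B \<subseteq> A" "A \<in> \<A>" "B \<in> \<A>"
        using \<C>(2) unfolding subset.chain_def by blast+
      then show ?thesis
        using AB unfolding \<A>_def by blast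
    qed
    moreover have "\<C> \<subseteq> \<A>"
      using \<C> by (simp add: subset.chain_def)
    ultimately show "\<Union>\<C> \<in> \<A>"
      using \<C>(1) unfolding \<A>_def by blast
  qed
  then obtain M where M: "M \<in> \<A>" "\<And>X. X \<in> \<A> \<Longrightarrow> M \<subseteq> X \<Longrightarrow> X = M"
    by blast
  have ME: "M \<subseteq> idempotents" and fM: "f \<in> M" and zM: "0 \<notin> M"
    and mM: "\<And>x y. x \<in> M \<Longrightarrow> y \<in> M \<Longrightarrow> x * y \<in> M"
    using M(1) by (auto simp: \<A>_def)
  have "g \<in> M" if g: "g \<in> idempotents" "\<forall>m\<in>M. m * g \<noteq> 0" for g
  proof -
    \<comment> \<open>This is the closure of \<open>M\<close> and \<open>g\<close> under products,
      as \<open>g\<close> is idempotent and commutes with \<open>M\<close>. The hypothesis on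
      \<open>g\<close> keeps \<open>0\<close> out of it, for \<open>g\<close> itself through
      \<open>f \<in> M\<close>. Maximality then gives \<open>X = M\<close>.\<close>
    define X where "X = M \<union> {g} \<union> (\<lambda>m. m * g) ` M"
    have gg: "g * g = g"
      using g(1) by (simp add: idempotents_iff)
    have com: "g * x = x * g" if "x \<in> M" for x
      using idempotent_commute g(1) that ME by blast
    have "x * y \<in> X" if "x \<in> X" "y \<in> X" for x y
    proof -
      have 1: "x * (y * g) \<in> X" "(x * g) * y \<in> X" "(x * g) * (y * g) \<in> X" "x * y \<in> X"
        if "x \<in> M" "y \<in> M" for x y
      proof -
        have "x * y \<in> M" "x * y * g \<in> X"
          using mM that by (auto simp: X_def)
        moreover have "(x * g) * y = x * y * g" "(x * g) * (y * g) = x * y * g"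
          using com[OF that(2)] gg by (metis mult.assoc)+
        ultimately show "x * (y * g) \<in> X" "(x * g) * y \<in> X" "(x * g) * (y * g) \<in> X" "x * y \<in> X"
          by (auto simp: X_def mult.assoc)
      qed
      have 2: "x * g \<in> X" "g * x \<in> X" "(x * g) * g \<in> X" "g * (x * g) \<in> X" if "x \<in> M" for x
      proof -
        have "x * g \<in> X"
          using that by (auto simp: X_def)
        moreover have "(x * g) * g = x * g" "g * (x * g) = x * g"
          using com[OF that] gg by (metis mult.assoc)+
        ultimately show "x * g \<in> X" "g * x \<in> X" "(x * g) * g \<in> X" "g * (x * g) \<in> X"
          using com[OF that] by simp_all
      qed
      have 3: "g * g \<in> X"
        by (simp add: gg X_def)
      from that consider "x \<in> M" | "x = g" | z where "z \<in> M" "x = z * g"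
        by (auto simp: X_def)
      moreover from that consider "y \<in> M" | "y = g" | z where "z \<in> M" "y = z * g"
        by (auto simp: X_def)
      ultimately show ?thesis
        by (metis 1 2 3)
    qed
    moreover have "X \<subseteq> idempotents"
      using ME g(1) by (auto simp: X_def idempotent_mult)
    moreover have "0 \<notin> X"
      using zM g(2) fM by (auto simp: X_def)
    ultimately have "X \<in> \<A>"
      using fM by (auto simp: \<A>_def X_def)
    then have "X = M"
      by (rule M(2)) (auto simp: X_def)
    then show ?thesis
      by (auto simp: X_def)
  qed
  then show thesis
    using that ME fM zM mM by blast
qed

text \<open>The character is the indicator of a maximal filter \<open>M\<close>. If no member of a
  cover \<open>F\<close> of \<open>e\<close> were in \<open>M\<close>, maximality would give each
  \<open>g\<close> in \<open>F\<close> an annihilator \<open>n g\<close> in \<open>M\<close>. An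
  element of \<open>M\<close> below \<open>e\<close> and below all \<open>n g\<close> is nonzero and
  annihilates \<open>F\<close>, against the covering property.\<close>

lemma tight_character_exists:
  fixes f :: "'s::inverse_semigroup_zero"
  assumes "f \<in> idempotents" "f \<noteq> 0"
  obtains \<theta> where "\<theta> \<in> tight_characters" "\<theta> f"
proof -
  obtain M where ME: "M \<subseteq> idempotents" and fM: "f \<in> M" and zM: "0 \<notin> M"
    and mM: "\<And>x y. x \<in> M \<Longrightarrow> y \<in> M \<Longrightarrow> x * y \<in> M"
    and max: "\<And>g. g \<in> idempotents \<Longrightarrow> \<forall>m\<in>M. m * g \<noteq> 0 \<Longrightarrow> g \<in> M"
    using maximal_filter_exists[OF assms] by blast
  \<comment> \<open>\<open>M\<close> is upward closed: if \<open>m\<close> lies below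
    \<open>g\<close>, then \<open>m' * g * m = m' * m\<close> is in \<open>M\<close>, so
    \<open>m' * g\<close> cannot vanish.\<close>
  have up: "g \<in> M" if "g \<in> idempotents" "m \<in> M" "m = g * m" for g m
  proof (rule max[OF that(1)], rule ballI)
    fix m' assume "m' \<in> M"
    then have "m' * g * m \<noteq> 0"
      using mM[OF _ that(2)] that(3) zM by (metis mult.assoc)
    then show "m' * g \<noteq> 0"
      by auto
  qed
  define \<theta> where "\<theta> = (\<lambda>e\<in>idempotents. e \<in> M)"
  have \<theta>: "\<theta> e \<longleftrightarrow> e \<in> M" if "e \<in> idempotents" for e
    using that by (simp add: \<theta>_def)
  have left: "e \<in> M" and right: "g \<in> M" if "e \<in> idempotents" "g \<in> idempotents" "e * g \<in> M" for e g
  proof -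
    show "e \<in> M"
      by (rule up[OF that(1,3)]) (use that in \<open>simp add: idempotents_iff flip: mult.assoc\<close>)
    show "g \<in> M"
      by (rule up[OF that(2,3)])
        (use that idempotent_commute[of e g] in \<open>simp add: idempotents_iff flip: mult.assoc\<close>)
  qed
  have "\<theta> (e * g) \<longleftrightarrow> \<theta> e \<and> \<theta> g" if "e \<in> idempotents" "g \<in> idempotents" for e g
    using \<theta> that idempotent_mult[OF that] left right mM by blast
  moreover have "\<not> \<theta> 0"
    using \<theta> zero_idempotent zM by blast
  moreover have "\<theta> f"
    using \<theta> assms(1) fM by blast
  moreover have "\<theta> \<in> extensional idempotents"
    by (simp add: \<theta>_def)
  ultimately have char: "\<theta> \<in> characters"
    using assms(1) unfolding characters_def by blast
  have "\<exists>g\<in>F. \<theta> g" if e: "e \<in> idempotents" "covers F e" "\<theta> e" for e F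
  proof (rule ccontr)
    assume F: "\<not> (\<exists>g\<in>F. \<theta> g)"
    have FE: "F \<subseteq> idempotents" "finite F"
      using e(2) by (auto simp: covers_def)
    have "\<forall>g\<in>F. \<exists>m\<in>M. m * g = 0"
      using F FE max \<theta> by blast
    then obtain n where n: "\<And>g. g \<in> F \<Longrightarrow> n g \<in> M \<and> n g * g = 0"
      by metis
    have "finite (n ` F)" "n ` F \<subseteq> idempotents" "\<forall>h\<in>n ` F. \<theta> h"
      using FE n ME \<theta> by auto
    then obtain m where m: "m \<in> idempotents" "\<theta> m" "nat_le m e" "\<forall>h\<in>n ` F. nat_le m h"
      using character_lower_bound[OF char _ _ _ e(1,3)] by blast
    have "m \<noteq> 0"
      using m(1,2) \<theta> zM by auto
    then obtain g where g: "g \<in> F" "m * g \<noteq> 0"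
      using e(2) m(1,3) by (auto simp: covers_def)
    have ng: "n g \<in> idempotents" "nat_le m (n g)"
      using m(4) g(1) n ME by auto
    have "m = m * n g"
      using ng nat_le_idempotent_iff[OF m(1)] idempotent_commute[OF m(1)] by simp
    then have "m * g = m * (n g * g)"
      by (metis mult.assoc)
    then show False
      using g n by simp
  qed
  then have "\<theta> \<in> tight_characters"
    using char by (auto simp: tight_characters_def)
  then show thesis
    using that fM assms(1) \<theta> by blast
qed

section \<open>Germs\<close>

lemma germ_rel_iff:
  "((s, \<theta>), (t, \<theta>')) \<in> germ_rel \<longleftrightarrow> \<theta>' = \<theta> \<and> \<theta> \<in> char_dom (star s * s) \<and>
     \<theta> \<in> char_dom (star t * t) \<and> (\<exists>u. nat_le u s \<and> nat_le u t \<and> \<theta> \<in> char_dom (star u * u))"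
  by (auto simp: germ_rel_def)

text \<open>Only transitivity needs an argument. If \<open>u\<close> lies below \<open>s\<close> and
  \<open>t\<close>, and \<open>v\<close> below \<open>t\<close> and \<open>w\<close>, with domain
  idempotents \<open>p\<close> and \<open>q\<close>, then \<open>u * q = t * (p * q) = v * p\<close>
  lies below both \<open>s\<close> and \<open>w\<close>, and \<theta> is still 1 at its domain
  idempotent \<open>p * q\<close>.\<close>

lemma equiv_germ_rel:
  "equiv {(s :: 's::inverse_semigroup_zero, \<theta>). \<theta> \<in> char_dom (star s * s)} germ_rel"
proof (rule equivI)
  show "refl_on {(s :: 's, \<theta>). \<theta> \<in> char_dom (star s * s)} germ_rel"
    using nat_le_refl by (fastforce simp: refl_on_def germ_rel_iff)
  show "sym (germ_rel :: (('s \<times> ('s \<Rightarrow> bool)) \<times> _) set)"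
    by (auto simp: sym_def germ_rel_iff)
  show "(germ_rel :: (('s \<times> ('s \<Rightarrow> bool)) \<times> _) set) \<subseteq>
      {(s, \<theta>). \<theta> \<in> char_dom (star s * s)} \<times> {(s, \<theta>). \<theta> \<in> char_dom (star s * s)}"
    by (auto simp: germ_rel_iff)
  have "\<exists>z. nat_le z s \<and> nat_le z w \<and> \<theta> \<in> char_dom (star z * z)"
    if u: "nat_le u s" "nat_le u t" "\<theta> \<in> char_dom (star u * u)"
      and v: "nat_le v t" "nat_le v w" "\<theta> \<in> char_dom (star v * v)"
    for s t u v w :: 's and \<theta>
  proof -
    define p where "p = star u * u"
    define q where "q = star v * v"
    have pq: "p \<in> idempotents" "q \<in> idempotents" "p * q \<in> idempotents" "p * q = q * p"
      by (simp_all add: p_def q_def star_mult_idempotent idempotent_mult idempotent_commute)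
    have "u * q = t * (p * q)" "u * q = s * (p * q)"
      using nat_le_eq[OF u(1)] nat_le_eq[OF u(2)] by (metis p_def mult.assoc)+
    moreover have "v * p = t * (p * q)" "v * p = w * (p * q)"
      using nat_le_eq[OF v(1)] nat_le_eq[OF v(2)] pq(4) by (metis q_def mult.assoc)+
    ultimately have "nat_le (u * q) s" "nat_le (u * q) w"
      using nat_le_mult_idempotent[OF pq(3)] by metis+
    moreover have "star (u * q) * (u * q) = p * q"
      using star_mult_mult_idempotent[OF pq(2)] by (simp add: p_def)
    moreover have "\<theta> \<in> char_dom (p * q)"
      using u(3) v(3) pq by (simp add: char_dom_def character_mult p_def q_def)
    ultimately show ?thesis
      by metis
  qed
  then show "trans (germ_rel :: (('s \<times> ('s \<Rightarrow> bool)) \<times> _) set)"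
    unfolding trans_def by (auto simp only: germ_rel_iff split_paired_All)
qed

lemma germ_eq_iff:
  assumes "\<theta> \<in> char_dom (star s * s)" "\<theta>' \<in> char_dom (star t * t)"
  shows "germ s \<theta> = germ t \<theta>' \<longleftrightarrow>
    \<theta> = \<theta>' \<and> (\<exists>u. nat_le u s \<and> nat_le u t \<and> \<theta> \<in> char_dom (star u * u))"
  using assms eq_equiv_class_iff[OF equiv_germ_rel, of "(s, \<theta>)" "(t, \<theta>')"]
  by (auto simp: germ_def germ_rel_iff)

lemma germ_mem_germ_set_iff:
  assumes "\<theta> \<in> char_dom (star s * s)" "V \<subseteq> char_dom (star t * t)"
  shows "germ s \<theta> \<in> germ_set t V \<longleftrightarrow>
    \<theta> \<in> V \<and> (\<exists>u. nat_le u s \<and> nat_le u t \<and> \<theta> \<in> char_dom (star u * u))"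
  using assms germ_eq_iff[OF assms(1)] unfolding germ_set_def by blast

text \<open>Writing \<open>u = s * p\<close>, conjugation by \<open>u\<close> is conjugation by
  \<open>s\<close> with a factor \<open>p\<close> on each side, and \<theta> is 1 at
  \<open>p\<close>. Hence the range of a germ does not depend on the representative.\<close>

lemma act_nat_le:
  fixes s :: "'s::inverse_semigroup_zero"
  assumes "nat_le u s" "\<theta> \<in> char_dom (star u * u)"
  shows "act u \<theta> = act s \<theta>"
proof -
  define p where "p = star u * u"
  have p: "p \<in> idempotents" and \<theta>: "\<theta> \<in> characters" "\<theta> p"
    using assms(2) by (simp_all add: p_def star_mult_idempotent char_dom_def)
  have u: "u = s * p"
    using nat_le_eq[OF assms(1)] by (simp add: p_def)
  have "\<theta> (star u * e * u) = \<theta> (star s * e * s)" if "e \<in> idempotents" for e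
  proof -
    have "star u * e * u = p * (star s * e * s) * p"
      by (subst (1 2) u) (simp add: star_mult star_idempotent[OF p] mult.assoc)
    then show ?thesis
      using that p \<theta> by (simp add: character_mult idempotent_mult idempotent_conj)
  qed
  then show ?thesis
    by (auto simp: act_def fun_eq_iff)
qed

section \<open>Domain and range of a germ\<close>

lemma gdom_germ:
  assumes "\<theta> \<in> char_dom (star s * s)"
  shows "gdom universal_groupoid (germ s \<theta>) = \<theta>"
proof -
  have "{\<theta>'. \<exists>t. (t, \<theta>') \<in> germ s \<theta>} = {\<theta>}"
    using assms nat_le_refl by (auto simp: germ_def germ_rel_iff)
  then show ?thesis
    by (simp add: universal_groupoid_def)
qed

lemma gran_germ:
  assumes "\<theta> \<in> char_dom (star s * s)"
  shows "gran universal_groupoid (germ s \<theta>) = act s \<theta>"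
proof -
  have "{act t \<theta>' | t \<theta>'. (t, \<theta>') \<in> germ s \<theta>} = {act s \<theta>}"
  proof (intro equalityI subsetI)
    fix \<phi> assume "\<phi> \<in> {act t \<theta>' | t \<theta>'. (t, \<theta>') \<in> germ s \<theta>}"
    then obtain t u where "\<phi> = act t \<theta>" "nat_le u s" "nat_le u t" "\<theta> \<in> char_dom (star u * u)"
      by (auto simp: germ_def germ_rel_iff)
    then show "\<phi> \<in> {act s \<theta>}"
      using act_nat_le by (metis singleton_iff)
  next
    fix \<phi> assume "\<phi> \<in> {act s \<theta>}"
    then show "\<phi> \<in> {act t \<theta>' | t \<theta>'. (t, \<theta>') \<in> germ s \<theta>}"
      using assms nat_le_refl by (auto simp: germ_def germ_rel_iff)
  qed
  then show ?thesis
    by (simp add: universal_groupoid_def)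
qed

section \<open>The action on characters and the invariance of the tight ones\<close>

lemma act_character:
  fixes s :: "'s::inverse_semigroup_zero"
  assumes "\<theta> \<in> char_dom (star s * s)"
  shows "act s \<theta> \<in> characters"
proof -
  have \<theta>: "\<theta> \<in> characters" "\<theta> (star s * s)"
    using assms by (auto simp: char_dom_def)
  have "act s \<theta> (s * star s)"
    using \<theta>(2) by (simp add: act_def mult_star_idempotent)
      (metis mult.assoc star_mult_star)
  moreover have "act s \<theta> (e * f) \<longleftrightarrow> act s \<theta> e \<and> act s \<theta> f"
    if "e \<in> idempotents" "f \<in> idempotents" for e f
    using that \<theta>(1) by (simp add: act_def idempotent_mult conj_mult character_mult idempotent_conj)
  moreover have "\<not> act s \<theta> 0"
    using \<theta>(1) by (simp add: act_def zero_idempotent character_zero)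
  moreover have "act s \<theta> \<in> extensional idempotents"
    by (simp add: act_def)
  ultimately show ?thesis
    unfolding characters_def using mult_star_idempotent by blast
qed

text \<open>Conjugating there and back multiplies \<open>e\<close> on both sides by
  \<open>star s * s\<close>, where \<theta> is 1. This yields injectivity of the range map on the
  germs of \<open>s\<close>.\<close>

lemma act_star_act:
  fixes s :: "'s::inverse_semigroup_zero"
  assumes "\<theta> \<in> char_dom (star s * s)"
  shows "act (star s) (act s \<theta>) = \<theta>"
proof
  fix e
  have \<theta>: "\<theta> \<in> characters" "\<theta> (star s * s)"
    using assms by (auto simp: char_dom_def)
  show "act (star s) (act s \<theta>) e = \<theta> e"
  proof (cases "e \<in> idempotents")
    case True
    have "s * e * star s \<in> idempotents"
      using idempotent_conj[OF True, of "star s"] by (simp add: star_star)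
    then have "act (star s) (act s \<theta>) e = \<theta> ((star s * s) * e * (star s * s))"
      using True by (simp add: act_def star_star mult.assoc)
    then show ?thesis
      using True \<theta> by (simp add: character_mult idempotent_mult star_mult_idempotent)
  next
    case False
    then show ?thesis
      using \<theta>(1) by (auto simp: act_def characters_def extensional_def)
  qed
qed

text \<open>A nonzero test element \<open>f\<close> below \<open>star s * e * s\<close> is carried
  to \<open>h = s * f * star s\<close>, which lies below \<open>e\<close> and is nonzero because
  \<open>f = star s * h * s\<close>. Some \<open>g\<close> in \<open>F\<close> then has
  \<open>h * g \<noteq> 0\<close>, and \<open>h * g\<close> is obtained from
  \<open>f * (star s * g * s)\<close> by multiplying with \<open>s\<close> and
  \<open>star s\<close>.\<close>

lemma covers_conj:
  fixes s :: "'s::inverse_semigroup_zero"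
  assumes "e \<in> idempotents" "covers F e"
  shows "covers ((\<lambda>g. star s * g * s) ` F) (star s * e * s)"
proof -
  have F: "finite F" "F \<subseteq> idempotents" "\<And>g. g \<in> F \<Longrightarrow> g = e * g"
    "\<And>f. f \<in> idempotents \<Longrightarrow> f \<noteq> 0 \<Longrightarrow> f = e * f \<Longrightarrow> \<exists>g\<in>F. f * g \<noteq> 0"
    using assms(2) by (auto simp: covers_def nat_le_idempotent_iff subset_iff)
  have "nat_le (star s * g * s) (star s * e * s)" if "g \<in> F" for g
  proof -
    have g: "g \<in> idempotents"
      using that F(2) by blast
    have "star s * g * s = star s * (e * g) * s"
      using F(3)[OF that] by simp
    then show ?thesis
      unfolding nat_le_idempotent_iff[OF idempotent_conj[OF g]] conj_mult[OF g] by simp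
  qed
  moreover have "\<exists>g\<in>F. f * (star s * g * s) \<noteq> 0"
    if f: "f \<in> idempotents" "f \<noteq> 0" "nat_le f (star s * e * s)" for f
  proof -
    define h where "h = s * f * star s"
    have f': "f = star s * e * s * f"
      using f by (simp add: nat_le_idempotent_iff)
    have "e * s * star s = s * star s * e"
      using idempotent_commute[OF assms(1) mult_star_idempotent] by (simp add: mult.assoc)
    \<comment> \<open>The trailing \<open>x\<close> lets this identity act as a rewrite rule inside
      longer products; the same holds for \<open>ee\<close> below.\<close>
    then have e: "e * (s * x) = s * (star s * (e * (s * x)))" for x
      using mult_idempotent_left_commute[OF assms(1), of s] by (metis mult.assoc)
    have h: "h \<in> idempotents"
      using idempotent_conj[OF f(1), of "star s"] by (simp add: h_def star_star)
    have ee: "e * (e * x) = e * x" for x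
      using assms(1) by (simp add: idempotents_iff flip: mult.assoc)
    have "h = e * h"
      unfolding h_def by (subst (1 2) f') (simp add: mult.assoc e[symmetric] ee)
    moreover have "f = star s * h * s"
    proof -
      have "f * (star s * s) = (star s * s) * f"
        by (rule idempotent_commute[OF f(1) star_mult_idempotent])
      moreover have "star s * s * f = f"
        using f' by (metis mult.assoc star_mult_star)
      ultimately show ?thesis
        unfolding h_def by (metis mult.assoc)
    qed
    then have "h \<noteq> 0"
      using f(2) by auto
    ultimately obtain g where g: "g \<in> F" "h * g \<noteq> 0"
      using F(4)[OF h] by blast
    have gE: "g \<in> idempotents"
      using g F(2) by blast
    have "star s * g * (s * star s) = star s * (s * star s) * g"
      using idempotent_commute[OF gE mult_star_idempotent] by (metis mult.assoc)
    then have "s * (f * (star s * g * s)) * star s = h * g"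
      unfolding h_def by (metis mult.assoc star_mult_star)
    then show ?thesis
      using g by force
  qed
  ultimately show ?thesis
    using F(1,2) by (auto simp: covers_def idempotent_conj)
qed

text \<open>A cover of \<open>e\<close> is pulled back by \<open>covers_conj\<close> to a cover of
  \<open>star s * e * s\<close>, to which tightness of \<theta> applies.\<close>

lemma act_tight_character:
  fixes s :: "'s::inverse_semigroup_zero"
  assumes "\<theta> \<in> char_dom (star s * s)" "\<theta> \<in> tight_characters"
  shows "act s \<theta> \<in> tight_characters"
proof -
  have "\<exists>g\<in>F. act s \<theta> g" if F: "e \<in> idempotents" "covers F e" "act s \<theta> e" for e F
  proof -
    have FE: "F \<subseteq> idempotents"
      using F(2) by (simp add: covers_def)
    have "\<theta> (star s * e * s)"
      using F by (simp add: act_def)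
    then obtain g where "g \<in> F" "\<theta> (star s * g * s)"
      using assms(2) covers_conj[OF F(1,2), of s] idempotent_conj[OF F(1), of s]
      unfolding tight_characters_def by blast
    then show ?thesis
      using FE by (auto simp: act_def)
  qed
  then show ?thesis
    using act_character[OF assms(1)] by (auto simp: tight_characters_def)
qed

section \<open>The topology of the tight groupoid\<close>

text \<open>Requiring openness of the predicate and of its negation makes the notion stable under
  all finite Boolean combinations, so that it reduces to single coordinates.\<close>

definition clopen_pred :: "'a topology \<Rightarrow> ('a \<Rightarrow> bool) \<Rightarrow> bool" where
  "clopen_pred X P \<longleftrightarrow> openin X {x \<in> topspace X. P x} \<and> openin X {x \<in> topspace X. \<not> P x}"

lemma clopen_pred_not: "clopen_pred X P \<Longrightarrow> clopen_pred X (\<lambda>x. \<not> P x)"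
  by (simp add: clopen_pred_def)

lemma clopen_pred_conj:
  assumes "clopen_pred X P" "clopen_pred X Q"
  shows "clopen_pred X (\<lambda>x. P x \<and> Q x)"
proof -
  have "{x \<in> topspace X. P x \<and> Q x} = {x \<in> topspace X. P x} \<inter> {x \<in> topspace X. Q x}"
    "{x \<in> topspace X. \<not> (P x \<and> Q x)} = {x \<in> topspace X. \<not> P x} \<union> {x \<in> topspace X. \<not> Q x}"
    by auto
  then show ?thesis
    using assms by (simp add: clopen_pred_def openin_Int openin_Un)
qed

lemma clopen_pred_disj:
  assumes "clopen_pred X P" "clopen_pred X Q"
  shows "clopen_pred X (\<lambda>x. P x \<or> Q x)"
  using clopen_pred_not[OF clopen_pred_conj[OF assms[THEN clopen_pred_not]]] by simp

lemma clopen_pred_iff: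
  assumes "clopen_pred X P" "clopen_pred X Q"
  shows "clopen_pred X (\<lambda>x. P x \<longleftrightarrow> Q x)"
proof -
  have "clopen_pred X (\<lambda>x. P x \<and> Q x \<or> \<not> P x \<and> \<not> Q x)"
    by (intro clopen_pred_disj clopen_pred_conj clopen_pred_not assms)
  moreover have "(\<lambda>x. P x \<and> Q x \<or> \<not> P x \<and> \<not> Q x) = (\<lambda>x. P x \<longleftrightarrow> Q x)"
    by auto
  ultimately show ?thesis
    by simp
qed

lemma clopen_pred_bex:
  assumes "finite F" "\<And>i. i \<in> F \<Longrightarrow> clopen_pred X (P i)"
  shows "clopen_pred X (\<lambda>x. \<exists>i\<in>F. P i x)"
  using assms
proof (induction F rule: finite_induct)
  case empty
  then show ?case
    by (simp add: clopen_pred_def)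
next
  case (insert i F)
  then show ?case
    using clopen_pred_disj[of X "P i" "\<lambda>x. \<exists>i\<in>F. P i x"] by simp
qed

text \<open>The index set may be infinite, so only closedness survives: the complement is a union of
  open sets.\<close>

lemma closedin_clopen_ball:
  assumes "\<And>i. i \<in> J \<Longrightarrow> clopen_pred X (P i)"
  shows "closedin X {x \<in> topspace X. \<forall>i\<in>J. P i x}"
proof -
  have "{x \<in> topspace X. \<forall>i\<in>J. P i x} = topspace X - (\<Union>i\<in>J. {x \<in> topspace X. \<not> P i x})"
    by auto
  moreover have "openin X (\<Union>i\<in>J. {x \<in> topspace X. \<not> P i x})"
    using assms by (intro openin_Union) (auto simp: clopen_pred_def)
  ultimately show ?thesis
    by (simp add: closedin_diff)
qed

section \<open>Compactness and continuity in the space of characters\<close>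

abbreviation bool_functions :: "('s::inverse_semigroup_zero \<Rightarrow> bool) topology" where
  "bool_functions \<equiv> product_topology (\<lambda>_. discrete_topology UNIV) idempotents"

lemma clopen_pred_coordinate:
  assumes "e \<in> idempotents"
  shows "clopen_pred bool_functions (\<lambda>\<theta>. \<theta> e)"
proof -
  have "continuous_map bool_functions (discrete_topology UNIV) (\<lambda>\<theta>. \<theta> e)"
    using continuous_map_product_projection[OF assms] .
  then have "openin bool_functions {\<theta> \<in> topspace bool_functions. \<theta> e \<in> U}" for U
    by (rule openin_continuous_map_preimage) simp
  from this[of "{True}"] this[of "{False}"] show ?thesis
    by (simp add: clopen_pred_def)
qed

lemma characters_subset: "characters \<subseteq> topspace bool_functions"
  by (auto simp: characters_def PiE_def)

lemma topspace_character_space: "topspace character_space = characters"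
  using characters_subset by (auto simp: character_space_def)

lemma openin_char_dom:
  assumes "e \<in> idempotents"
  shows "openin character_space (char_dom e)"
proof -
  have "char_dom e = {\<theta> \<in> topspace bool_functions. \<theta> e} \<inter> characters"
    using characters_subset by (auto simp: char_dom_def)
  then show ?thesis
    using clopen_pred_coordinate[OF assms]
    by (auto simp: character_space_def clopen_pred_def openin_subtopology)
qed

text \<open>The set is closed in the compact product of two-point spaces: \<open>?M\<close>
  expresses multiplicativity, \<open>?Z\<close> the values at \<open>0\<close> and \<open>e\<close>,
  and \<open>?C\<close> tightness. Each instance of these conditions involves finitely many
  coordinates, as covers are finite.\<close>

lemma compactin_tight_char_dom:
  fixes e :: "'s::inverse_semigroup_zero"
  assumes "e \<in> idempotents"
  shows "compactin character_space (char_dom e \<inter> tight_characters)"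
proof -
  let ?T = "topspace bool_functions :: ('s \<Rightarrow> bool) set"
  let ?M = "{\<theta> \<in> ?T. \<forall>p\<in>idempotents \<times> idempotents. \<theta> (fst p * snd p) \<longleftrightarrow> \<theta> (fst p) \<and> \<theta> (snd p)}"
  \<comment> \<open>Fixing the value 1 at \<open>e\<close> also makes \<theta> non-zero, which alone
    is in general not a closed condition. The singleton index set gives the shape of
    \<open>closedin_clopen_ball\<close>.\<close>
  let ?Z = "{\<theta> \<in> ?T. \<forall>i\<in>{e}. \<not> \<theta> 0 \<and> \<theta> i}"
  let ?C = "{\<theta> \<in> ?T. \<forall>(g, F)\<in>{(g, F). g \<in> idempotents \<and> covers F g}. \<not> \<theta> g \<or> (\<exists>h\<in>F. \<theta> h)}"
  have "closedin bool_functions ?M" "closedin bool_functions ?Z"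
    using assms
    by (intro closedin_clopen_ball clopen_pred_iff clopen_pred_conj clopen_pred_not
        clopen_pred_coordinate; auto simp: idempotent_mult zero_idempotent)+
  moreover have "closedin bool_functions ?C"
  proof (rule closedin_clopen_ball)
    fix i assume "i \<in> {(g :: 's, F). g \<in> idempotents \<and> covers F g}"
    then obtain g F where i: "i = (g, F)" "g \<in> idempotents" "covers F g"
      by blast
    then have "clopen_pred bool_functions (\<lambda>\<theta>. \<not> \<theta> g \<or> (\<exists>h\<in>F. \<theta> h))"
      by (intro clopen_pred_disj clopen_pred_not clopen_pred_bex clopen_pred_coordinate)
        (auto simp: covers_def)
    then show "clopen_pred bool_functions
        (\<lambda>\<theta>. case i of (g, F) \<Rightarrow> \<not> \<theta> g \<or> (\<exists>h\<in>F. \<theta> h))"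
      by (simp add: i)
  qed
  ultimately have "closedin bool_functions (?M \<inter> ?Z \<inter> ?C)"
    by blast
  moreover have "char_dom e \<inter> tight_characters = ?M \<inter> ?Z \<inter> ?C"
    using assms characters_subset
    by (auto simp: char_dom_def tight_characters_def characters_def PiE_def)
  moreover have "compact_space (bool_functions :: ('s \<Rightarrow> bool) topology)"
    by (simp add: compact_space_product_topology compact_space_discrete_topology)
  ultimately have "compactin bool_functions (char_dom e \<inter> tight_characters)"
    by (metis closedin_compact_space)
  then show ?thesis
    by (auto simp: character_space_def compactin_subtopology char_dom_def)
qed

lemma Hausdorff_character_space: "Hausdorff_space character_space"
  by (simp add: character_space_def Hausdorff_space_subtopology Hausdorff_space_product_topology
      Hausdorff_space_discrete_topology)

lemma continuous_map_act:
  fixes s :: "'s::inverse_semigroup_zero"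
  shows "continuous_map (subtopology character_space (char_dom (star s * s))) character_space (act s)"
proof -
  have "continuous_map (subtopology character_space (char_dom (star s * s)))
      (discrete_topology UNIV) (\<lambda>\<theta>. act s \<theta> e)" if "e \<in> idempotents" for e
  proof -
    have "continuous_map bool_functions (discrete_topology UNIV) (\<lambda>\<theta>. \<theta> (star s * e * s))"
      by (rule continuous_map_product_projection[OF idempotent_conj[OF that]])
    then show ?thesis
      using that by (simp add: act_def character_space_def continuous_map_from_subtopology)
  qed
  then show ?thesis
    using act_character
    by (auto simp: character_space_def continuous_map_in_subtopology continuous_map_componentwise
        act_def)
qed

section \<open>The topology on germs\<close>

lemma arrows_universal_groupoid:
  "arrows universal_groupoid = topology_generated_by
     {germ_set s U | s U. openin character_space U \<and> U \<subseteq> char_dom (star s * s)}"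
  by (simp add: universal_groupoid_def)

lemma openin_germ_set:
  assumes "openin character_space U" "U \<subseteq> char_dom (star s * s)"
  shows "openin (arrows universal_groupoid) (germ_set s U)"
  unfolding arrows_universal_groupoid by (rule topology_generated_by_Basis) (use assms in blast)

lemma topspace_arrows_cases:
  assumes "\<gamma> \<in> topspace (arrows universal_groupoid)"
  obtains s \<theta> where "\<theta> \<in> char_dom (star s * s)" "\<gamma> = germ s \<theta>"
  using assms by (auto simp: arrows_universal_groupoid germ_set_def)

text \<open>Continuity is tested on the generating sets: [s, \<theta>] lies in the set given by
  \<open>t\<close> and \<open>V\<close> iff \<theta> is in \<open>V\<close> and in the domain of
  some common lower bound of \<open>s\<close> and \<open>t\<close>, and these domains are open. The
  map transports compactness to germs and pulls open sets of germs back to characters.\<close>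

lemma continuous_map_germ:
  fixes s :: "'s::inverse_semigroup_zero"
  shows "continuous_map (subtopology character_space (char_dom (star s * s)))
    (arrows universal_groupoid) (germ s)"
proof -
  let ?D = "char_dom (star s * s)"
  have top: "topspace (subtopology character_space ?D) = ?D"
    by (auto simp: topspace_character_space char_dom_def)
  have "openin (subtopology character_space ?D) (germ s -` germ_set t V \<inter> ?D)"
    if V: "openin character_space V" "V \<subseteq> char_dom (star t * t)" for t V
  proof -
    have "germ s -` germ_set t V \<inter> ?D =
        (\<Union>u\<in>{u. nat_le u s \<and> nat_le u t}. char_dom (star u * u)) \<inter> V \<inter> ?D"
      using germ_mem_germ_set_iff[OF _ V(2), of _ s] by auto
    moreover have "openin character_space
        ((\<Union>u\<in>{u. nat_le u s \<and> nat_le u t}. char_dom (star u * u)) \<inter> V)"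
      using V(1) by (intro openin_Int openin_Union) (auto simp: openin_char_dom star_mult_idempotent)
    ultimately show ?thesis
      by (auto simp: openin_subtopology)
  qed
  \<comment> \<open>The criterion for generated topologies also asks that the image lie in the union
    of the generators; here the image is itself a generator.\<close>
  moreover have "germ s ` ?D \<in> {germ_set s U | s U. openin character_space U \<and> U \<subseteq> char_dom (star s * s)}"
    using openin_char_dom[OF star_mult_idempotent, of s] by (auto simp: germ_set_def)
  ultimately show ?thesis
    unfolding arrows_universal_groupoid continuous_on_generated_topo_iff top by blast
qed

section \<open>Germs at tight characters as compact local bisections\<close>

abbreviation tight_dom :: "'s::inverse_semigroup_zero \<Rightarrow> ('s \<Rightarrow> bool) set" where
  "tight_dom s \<equiv> char_dom (star s * s) \<inter> tight_characters"

lemma germ_set_eq_image: "germ_set s U = germ s ` U"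
  by (auto simp: germ_set_def)

lemma arrows_tight_groupoid:
  "arrows tight_groupoid = subtopology (arrows universal_groupoid)
     {\<gamma>. gdom universal_groupoid \<gamma> \<in> tight_characters \<and> gran universal_groupoid \<gamma> \<in> tight_characters}"
  by (simp add: tight_groupoid_def groupoid_restrict_def)

lemma gdom_tight_groupoid: "gdom tight_groupoid = gdom universal_groupoid"
  and gran_tight_groupoid: "gran tight_groupoid = gran universal_groupoid"
  by (simp_all add: tight_groupoid_def groupoid_restrict_def)

text \<open>By invariance the range of a germ is tight once its domain is. This identifies the germs
  of \<open>s\<close> at tight characters with the trace of an open set on the tight
  groupoid.\<close>

lemma germ_set_tight_dom:
  fixes s :: "'s::inverse_semigroup_zero"
  shows "germ_set s (tight_dom s) = germ_set s (char_dom (star s * s)) \<inter>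
    {\<gamma>. gdom universal_groupoid \<gamma> \<in> tight_characters \<and> gran universal_groupoid \<gamma> \<in> tight_characters}"
  by (auto simp: germ_set_eq_image gdom_germ gran_germ act_tight_character)

lemma openin_germ_set_tight_dom: "openin (arrows tight_groupoid) (germ_set s (tight_dom s))"
  unfolding arrows_tight_groupoid germ_set_tight_dom
  using openin_germ_set[OF openin_char_dom[OF star_mult_idempotent]] by (auto simp: openin_subtopology)

lemma continuous_map_gdom:
  "continuous_map (subtopology (arrows universal_groupoid) (germ_set s (char_dom (star s * s))))
     (subtopology character_space (char_dom (star s * s))) (gdom universal_groupoid)"
proof -
  let ?D = "char_dom (star s * s)"
  let ?X = "subtopology (arrows universal_groupoid) (germ_set s ?D)"
  have top: "topspace ?X = germ_set s ?D"
    using openin_subset[OF openin_germ_set[OF openin_char_dom[OF star_mult_idempotent]], of s] by auto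
  have "openin ?X {\<gamma> \<in> germ_set s ?D. gdom universal_groupoid \<gamma> \<in> U}"
    if U: "openin character_space U" for U
  proof -
    have "{\<gamma> \<in> germ_set s ?D. gdom universal_groupoid \<gamma> \<in> U} = germ_set s (U \<inter> ?D) \<inter> germ_set s ?D"
      by (auto simp: germ_set_eq_image gdom_germ)
    moreover have "openin (arrows universal_groupoid) (germ_set s (U \<inter> ?D))"
      using U by (intro openin_germ_set) (auto simp: openin_char_dom star_mult_idempotent)
    ultimately show ?thesis
      by (auto simp: openin_subtopology)
  qed
  then have "continuous_map ?X character_space (gdom universal_groupoid)"
    unfolding continuous_map top
    by (auto simp: topspace_character_space germ_set_eq_image gdom_germ char_dom_def)
  then show ?thesis
    unfolding continuous_map_in_subtopology top by (auto simp: germ_set_eq_image gdom_germ)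
qed

text \<open>Compactness comes from \<open>continuous_map_germ\<close> and the compactness of
  \<open>tight_dom s\<close>. Domain and range are continuous and injective on this compact set with
  values in a Hausdorff space, hence homeomorphisms onto their images.\<close>

lemma compact_local_bisection_tight_dom:
  fixes s :: "'s::inverse_semigroup_zero"
  shows "compact_local_bisection tight_groupoid (germ_set s (tight_dom s))"
proof -
  let ?D = "char_dom (star s * s)" and ?U = "germ_set s (tight_dom s)"
  let ?A = "arrows universal_groupoid :: 's germ_class topology"
  let ?X = "subtopology ?A ?U"
  have "compactin (subtopology character_space ?D) (tight_dom s)"
    using compactin_tight_char_dom[OF star_mult_idempotent, of s] by (simp add: compactin_subtopology)
  then have compact: "compactin ?A ?U"
    unfolding germ_set_eq_image by (rule image_compactin[OF _ continuous_map_germ])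
  have U: "?U \<subseteq> germ_set s ?D"
    by (auto simp: germ_set_eq_image)
  have top: "topspace ?X = ?U"
    using compactin_subset_topspace[OF compact] by auto
  have sub: "subtopology (arrows tight_groupoid) ?U = ?X"
    unfolding arrows_tight_groupoid subtopology_subtopology germ_set_tight_dom
    by (rule arg_cong[of _ _ "subtopology ?A"]) blast
  \<comment> \<open>Stated for a general \<open>f\<close> so as to serve both the domain and the
    range map. As the image consists of tight characters, the subspace topologies from
    \<open>units tight_groupoid\<close> and \<open>character_space\<close> agree on it.\<close>
  have homeo: "homeomorphic_map ?X (subtopology (units tight_groupoid) (f ` ?U)) f"
    if f: "continuous_map ?X character_space f" "inj_on f ?U" "f ` ?U \<subseteq> tight_characters"
    for f :: "'s germ_class \<Rightarrow> 's \<Rightarrow> bool"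
  proof -
    have "subtopology (units tight_groupoid) (f ` ?U) = subtopology character_space (f ` ?U)"
      using f(3) by (simp add: tight_groupoid_def groupoid_restrict_def universal_groupoid_def
          subtopology_subtopology Int_absorb1)
    moreover have "homeomorphic_map ?X (subtopology character_space (f ` ?U)) f"
    proof (rule continuous_imp_homeomorphic_map)
      show "f ` topspace ?X = topspace (subtopology character_space (f ` ?U))"
        using f(1) unfolding continuous_map_def top by (auto simp: top)
    qed (use f compact top in \<open>auto simp: compact_space_subtopology Hausdorff_space_subtopology
        Hausdorff_character_space continuous_map_in_subtopology\<close>)
    ultimately show ?thesis
      by simp
  qed
  have gdom: "continuous_map ?X (subtopology character_space ?D) (gdom universal_groupoid)"
    using continuous_map_gdom U by (rule continuous_map_from_subtopology_mono)
  \<comment> \<open>On the germs of \<open>s\<close> the range map is the domain map followed by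
    \<open>act s\<close>.\<close>
  have "continuous_map ?X character_space (gran universal_groupoid)"
    by (rule continuous_map_eq[OF continuous_map_compose[OF gdom continuous_map_act]])
      (auto simp: top germ_set_eq_image gdom_germ gran_germ)
  moreover have "inj_on (gran universal_groupoid) ?U"
  proof (rule inj_onI, unfold germ_set_eq_image, clarsimp simp: gran_germ)
    fix \<theta> \<phi> assume "act s \<theta> = act s \<phi>" "\<theta> \<in> ?D" "\<phi> \<in> ?D"
    then have "\<theta> = \<phi>"
      using act_star_act by metis
    then show "germ s \<theta> = germ s \<phi>"
      by simp
  qed
  moreover have "gran universal_groupoid ` ?U \<subseteq> tight_characters"
    "gdom universal_groupoid ` ?U \<subseteq> tight_characters"
    by (auto simp: germ_set_tight_dom)
  moreover have "inj_on (gdom universal_groupoid) ?U"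
    by (rule inj_onI) (auto simp: germ_set_eq_image gdom_germ)
  moreover have "compactin (arrows tight_groupoid) ?U"
    using compact germ_set_tight_dom[of s]
    by (simp add: arrows_tight_groupoid compactin_subtopology)
  ultimately show ?thesis
    unfolding compact_local_bisection_def sub gdom_tight_groupoid gran_tight_groupoid
    using homeo gdom openin_germ_set_tight_dom by (simp add: continuous_map_in_subtopology)
qed

text \<open>A basic neighbourhood of \<theta> prescribes the value 1 on a finite set
  \<open>P\<close> and 0 on a finite set \<open>Q\<close>. With \<open>p\<close> below
  \<open>e\<close> and \<open>P\<close> and \<theta>(p) = 1, tightness prevents the products of
  \<open>p\<close> with \<open>Q\<close> from covering \<open>p\<close>, so some nonzero
  \<open>f\<close> below \<open>p\<close> annihilates them. Every character that is 1 at
  \<open>f\<close> then has the prescribed values; \<theta> itself need not be 1 at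
  \<open>f\<close>.\<close>

lemma idempotent_basis_tight:
  fixes V :: "('s::inverse_semigroup_zero \<Rightarrow> bool) set"
  assumes V: "openin character_space V" "\<theta> \<in> V" and tight: "\<theta> \<in> tight_characters"
    and e: "e \<in> idempotents" "\<theta> e"
  obtains f where "f \<in> idempotents" "f \<noteq> 0" "nat_le f e" "char_dom f \<subseteq> V"
proof -
  have \<theta>: "\<theta> \<in> characters"
    using tight by (simp add: tight_characters_def)
  obtain W where W: "openin bool_functions W" "V = W \<inter> characters"
    using V(1) by (auto simp: character_space_def openin_subtopology)
  then have "\<theta> \<in> W"
    using V(2) by simp
  then obtain U where U: "finite {i \<in> idempotents. U i \<noteq> UNIV}" "\<theta> \<in> Pi\<^sub>E idempotents U"
    "Pi\<^sub>E idempotents U \<subseteq> W"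
    using W(1) unfolding openin_product_topology_alt by fastforce
  define N where "N = {i \<in> idempotents. U i \<noteq> UNIV}"
  define P where "P = {i \<in> N. \<theta> i}"
  define Q where "Q = {i \<in> N. \<not> \<theta> i}"
  have "finite N"
    using U(1) by (simp add: N_def)
  then have fin: "finite P" "finite Q"
    by (simp_all add: P_def Q_def)
  have idem: "P \<subseteq> idempotents" "Q \<subseteq> idempotents"
    by (auto simp: N_def P_def Q_def)
  obtain p where p: "p \<in> idempotents" "\<theta> p" "nat_le p e" "\<forall>g\<in>P. nat_le p g"
    using character_lower_bound[OF \<theta> fin(1) idem(1) _ e] by (auto simp: P_def)
  have "\<not> covers ((\<lambda>g. p * g) ` Q) p"
  proof
    assume "covers ((\<lambda>g. p * g) ` Q) p"
    then obtain g where "g \<in> Q" "\<theta> (p * g)"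
      using tight p(1,2) unfolding tight_characters_def by blast
    then show False
      using \<theta> p(1) idem(2) by (auto simp: character_mult Q_def)
  qed
  moreover have "finite ((\<lambda>g. p * g) ` Q)" "(\<lambda>g. p * g) ` Q \<subseteq> idempotents"
    "\<forall>g\<in>(\<lambda>g. p * g) ` Q. nat_le g p"
    using fin(2) idem(2) p(1) by (auto simp: idempotent_mult nat_le_mult_idempotent)
  ultimately obtain f where f: "f \<in> idempotents" "f \<noteq> 0" "nat_le f p" "\<forall>g\<in>Q. f * (p * g) = 0"
    unfolding covers_def by blast
  have "\<phi> \<in> V" if "\<phi> \<in> char_dom f" for \<phi>
  proof -
    have \<phi>: "\<phi> \<in> characters" "\<phi> f"
      using that by (simp_all add: char_dom_def)
    then have "\<phi> p"
      using character_mono f(1,3) p(1) by blast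
    then have "\<phi> g" if "g \<in> P" for g
      using character_mono \<phi>(1) p that idem(1) by blast
    moreover have "\<not> \<phi> g" if "g \<in> Q" for g
    proof
      assume "\<phi> g"
      then have "\<phi> (f * (p * g))"
        using \<phi> \<open>\<phi> p\<close> f(1) p(1) that idem(2) by (auto simp: character_mult idempotent_mult)
      then show False
        using f(4) that character_zero[OF \<phi>(1)] by simp
    qed
    ultimately have agree: "\<phi> i = \<theta> i" if "i \<in> N" for i
      using that by (auto simp: P_def Q_def)
    have "\<phi> i \<in> U i" if "i \<in> idempotents" for i
    proof (cases "i \<in> N")
      case True
      then show ?thesis
        using agree U(2) that by auto
    next
      case False
      then show ?thesis
        using that by (simp add: N_def)
    qed
    then have "\<phi> \<in> Pi\<^sub>E idempotents U"
      using \<phi>(1) by (simp add: PiE_iff characters_def)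
    then show ?thesis
      using U(3) W(2) \<phi>(1) by blast
  qed
  then show thesis
    using that f(1,2) idempotent_nat_le_trans[OF f(1) p(1) f(3) p(3)] by blast
qed

section \<open>Singular elements and singular functions\<close>

lemma contracted_mult_idempotent:
  fixes a :: "'s::inverse_semigroup_zero \<Rightarrow> 'k::{comm_ring, comm_monoid_mult}"
  assumes "f \<noteq> 0"
  shows "contracted_mult a (contracted_of f) u =
    (if u = 0 then 0 else \<Sum>t\<in>{t. a t \<noteq> 0 \<and> t * f = u}. a t)"
\<comment> \<open>Over the zero ring \<open>contracted_of f\<close> has empty support instead of
  {f}; a nonzero coefficient of \<open>a\<close> excludes that ring.\<close>
proof (cases "\<exists>t. a t \<noteq> 0")
  case True
  then obtain t where "a t * 1 \<noteq> 0"
    by auto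
  then have one: "(1 :: 'k) \<noteq> 0"
    by (metis mult_zero_right)
  have "{(s, t). a s \<noteq> 0 \<and> (contracted_of f t :: 'k) \<noteq> 0 \<and> s * t = u} =
      (\<lambda>s. (s, f)) ` {t. a t \<noteq> 0 \<and> t * f = u}"
    using assms one by (auto simp: contracted_of_def)
  moreover have "inj_on (\<lambda>s. (s, f)) {t. a t \<noteq> 0 \<and> t * f = u}"
    by (auto simp: inj_on_def)
  ultimately show ?thesis
    using assms by (simp add: contracted_mult_def sum.reindex contracted_of_def)
next
  case False
  then show ?thesis
    by (simp add: contracted_mult_def)
qed

text \<open>Only an inclusion holds, since coefficients of different \<open>t\<close> with the same
  \<open>t * f\<close> may cancel.\<close>

lemma contracted_mult_idempotent_support:
  fixes a :: "'s::inverse_semigroup_zero \<Rightarrow> 'k::{comm_ring, comm_monoid_mult}"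
  assumes "f \<noteq> 0"
  shows "{u. contracted_mult a (contracted_of f) u \<noteq> 0} \<subseteq> (\<lambda>t. t * f) ` {t. a t \<noteq> 0} - {0}"
proof
  fix u assume "u \<in> {u. contracted_mult a (contracted_of f) u \<noteq> 0}"
  then have "u \<noteq> 0" "(\<Sum>t\<in>{t. a t \<noteq> 0 \<and> t * f = u}. a t) \<noteq> 0"
    by (simp_all add: contracted_mult_idempotent[OF assms] split: if_splits)
  then have "{t. a t \<noteq> 0 \<and> t * f = u} \<noteq> {}"
    by (metis sum.empty)
  then show "u \<in> (\<lambda>t. t * f) ` {t. a t \<noteq> 0} - {0}"
    using \<open>u \<noteq> 0\<close> by blast
qed

section \<open>The values of \<open>Psi\<close>\<close>

abbreviation tight_germs :: "'s::inverse_semigroup_zero \<Rightarrow> 's germ_class set" where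
  "tight_germs s \<equiv> germ_set s (tight_dom s)"

lemma Psi_superset:
  assumes "finite A" "{s. a s \<noteq> 0} \<subseteq> A"
  shows "Psi a \<gamma> = (\<Sum>s\<in>A. a s * char_fun (tight_germs s) \<gamma>)"
  unfolding Psi_def using assms by (intro sum.mono_neutral_left) auto

text \<open>A common lower bound \<open>u\<close> of \<open>s\<close> and \<open>t\<close> can be
  cut down to \<open>u * f\<close>, which lies below \<open>t * f\<close> and still has \<theta> in
  its domain because \<theta>(f) = 1. Conversely \<open>t * f\<close> is below
  \<open>t\<close>.\<close>

lemma germ_mem_tight_germs_mult:
  fixes s :: "'s::inverse_semigroup_zero"
  assumes \<theta>: "\<theta> \<in> char_dom (star s * s)" and f: "f \<in> idempotents" "\<theta> f"
  shows "germ s \<theta> \<in> tight_germs (t * f) \<longleftrightarrow> germ s \<theta> \<in> tight_germs t"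
proof -
  have char: "\<theta> \<in> characters"
    using \<theta> by (simp add: char_dom_def)
  have dom: "\<theta> \<in> char_dom (star (u * f) * (u * f)) \<longleftrightarrow> \<theta> \<in> char_dom (star u * u)" for u
    using char f
    by (simp add: star_mult_mult_idempotent char_dom_def character_mult star_mult_idempotent)
  have "(\<exists>u. nat_le u s \<and> nat_le u (t * f) \<and> \<theta> \<in> char_dom (star u * u)) \<longleftrightarrow>
      (\<exists>u. nat_le u s \<and> nat_le u t \<and> \<theta> \<in> char_dom (star u * u))"
  proof (intro iffI; elim exE conjE)
    fix u assume u: "nat_le u s" "nat_le u (t * f)" "\<theta> \<in> char_dom (star u * u)"
    have "u = t * (f * (star u * u))"
      using nat_le_eq[OF u(2)] by (simp add: mult.assoc)
    then have "nat_le u t"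
      using nat_le_mult_idempotent[OF idempotent_mult[OF f(1) star_mult_idempotent]] by metis
    then show "\<exists>u. nat_le u s \<and> nat_le u t \<and> \<theta> \<in> char_dom (star u * u)"
      using u by blast
  next
    fix u assume u: "nat_le u s" "nat_le u t" "\<theta> \<in> char_dom (star u * u)"
    have com: "star u * u * f = f * (star u * u)"
      by (rule idempotent_commute[OF star_mult_idempotent f(1)])
    have "u * f = s * (star u * u * f)" "u * f = (t * f) * (star u * u)"
      using nat_le_eq[OF u(1)] nat_le_eq[OF u(2)] com by (metis mult.assoc)+
    then have "nat_le (u * f) s" "nat_le (u * f) (t * f)"
      using nat_le_mult_idempotent f(1) star_mult_idempotent idempotent_mult by metis+
    then show "\<exists>u. nat_le u s \<and> nat_le u (t * f) \<and> \<theta> \<in> char_dom (star u * u)"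
      using u(3) dom by blast
  qed
  then show ?thesis
    by (simp add: germ_mem_germ_set_iff[OF \<theta>] dom)
qed

lemma Psi_contracted_mult_idempotent:
  fixes a :: "'s::inverse_semigroup_zero \<Rightarrow> 'k::{comm_ring, comm_monoid_mult}"
  assumes a: "a \<in> contracted_algebra"
    and \<theta>: "\<theta> \<in> char_dom (star s * s)" and f: "f \<in> idempotents" "\<theta> f"
  shows "Psi (contracted_mult a (contracted_of f)) (germ s \<theta>) = Psi a (germ s \<theta>)"
proof -
  define A where "A = {t. a t \<noteq> 0}"
  define \<gamma> where "\<gamma> = germ s \<theta>"
  have A: "finite A"
    using a by (simp add: contracted_algebra_def A_def)
  have f0: "f \<noteq> 0"
    using \<theta> f(2) character_zero by (auto simp: char_dom_def)
  \<comment> \<open>Terms with \<open>t * f = 0\<close> are absent from the contracted product; in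
    the grouped sum they contribute nothing either, as no character is 1 at
    \<open>0\<close>.\<close>
  have zero: "char_fun (germ_set 0 (char_dom 0 \<inter> tight_characters)) \<gamma> = (0 :: 'k)"
    by (auto simp: char_fun_def germ_set_def char_dom_def character_zero)
  have "Psi (contracted_mult a (contracted_of f)) \<gamma> = (\<Sum>u\<in>(\<lambda>t. t * f) ` A.
      contracted_mult a (contracted_of f) u * char_fun (tight_germs u) \<gamma>)"
    using A contracted_mult_idempotent_support[OF f0, of a]
    by (intro Psi_superset) (auto simp: A_def)
  also have "\<dots> = (\<Sum>u\<in>(\<lambda>t. t * f) ` A. \<Sum>t\<in>{t \<in> A. t * f = u}.
      a t * char_fun (tight_germs (t * f)) \<gamma>)"
    by (rule sum.cong[OF refl])
      (auto simp: contracted_mult_idempotent[OF f0] sum_distrib_right zero A_def)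
  also have "\<dots> = (\<Sum>t\<in>A. a t * char_fun (tight_germs (t * f)) \<gamma>)"
    by (rule sum.image_gen[symmetric]) (rule A)
  also have "\<dots> = Psi a \<gamma>"
    by (simp add: Psi_def A_def char_fun_def \<gamma>_def germ_mem_tight_germs_mult[OF \<theta> f])
  finally show ?thesis
    by (simp add: \<gamma>_def)
qed

text \<open>The algebra is spanned by sets of arrows, and different semigroup elements may have the
  same set of tight germs. Their coefficients are therefore collected in \<open>c\<close>.\<close>

lemma Psi_steinberg_algebra:
  fixes a :: "'s::inverse_semigroup_zero \<Rightarrow> 'k::{comm_ring, comm_monoid_mult}"
  assumes "a \<in> contracted_algebra"
  shows "Psi a \<in> steinberg_algebra tight_groupoid"
proof -
  define A where "A = {t. a t \<noteq> 0}"
  define c where "c U = (\<Sum>s\<in>{s \<in> A. tight_germs s = U}. a s)" for U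
  have A: "finite A"
    using assms by (simp add: contracted_algebra_def A_def)
  have "Psi a \<gamma> = (\<Sum>U\<in>tight_germs ` A. c U * char_fun U \<gamma>)" for \<gamma>
  proof -
    have "Psi a \<gamma> = (\<Sum>U\<in>tight_germs ` A. \<Sum>s\<in>{s \<in> A. tight_germs s = U}.
        a s * char_fun (tight_germs s) \<gamma>)"
      unfolding Psi_def A_def[symmetric] by (rule sum.image_gen) (rule A)
    also have "\<dots> = (\<Sum>U\<in>tight_germs ` A. c U * char_fun U \<gamma>)"
      by (intro sum.cong refl) (simp add: c_def sum_distrib_right)
    finally show ?thesis .
  qed
  then have "Psi a = (\<lambda>\<gamma>. \<Sum>U\<in>tight_germs ` A. c U * char_fun U \<gamma>)"
    by (rule ext)
  moreover have "finite (tight_germs ` A)" "\<forall>U\<in>tight_germs ` A. compact_local_bisection tight_groupoid U"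
    using A compact_local_bisection_tight_dom by auto
  ultimately show ?thesis
    unfolding steinberg_algebra_def by blast
qed

section \<open>Singular elements give singular functions\<close>

lemma Psi_singular:
  fixes a :: "'s::inverse_semigroup_zero \<Rightarrow> 'k::{comm_ring, comm_monoid_mult}"
  assumes a: "a \<in> singular_ideal"
  shows "Psi a \<in> singular_functions tight_groupoid"
proof -
  let ?X = "{\<gamma>. gdom universal_groupoid \<gamma> \<in> tight_characters \<and>
    gran universal_groupoid \<gamma> \<in> tight_characters}"
  have ac: "a \<in> contracted_algebra"
    using a by (simp add: singular_ideal_def)
  have "W = {}" if W: "openin (arrows tight_groupoid) W" "\<forall>\<gamma>\<in>W. Psi a \<gamma> \<noteq> 0"
    for W :: "'s germ_class set"
  proof (rule ccontr)
    assume "W \<noteq> {}"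
    then obtain \<gamma> where \<gamma>: "\<gamma> \<in> W"
      by blast
    obtain W' where W': "openin (arrows universal_groupoid) W'" "W = W' \<inter> ?X"
      using W(1) by (auto simp: arrows_tight_groupoid openin_subtopology)
    have "\<gamma> \<in> topspace (arrows universal_groupoid)"
      using \<gamma> W' openin_subset by blast
    then obtain s \<theta> where s: "\<theta> \<in> char_dom (star s * s)" "\<gamma> = germ s \<theta>"
      by (rule topspace_arrows_cases)
    let ?D = "char_dom (star s * s)"
    have \<theta>: "\<theta> \<in> tight_characters" "\<theta> (star s * s)"
      using \<gamma> W'(2) s by (auto simp: gdom_germ char_dom_def)
    have "topspace (subtopology character_space ?D) = ?D"
      by (auto simp: topspace_character_space char_dom_def)
    \<comment> \<open>The open set of germs is pulled back along \<open>germ s\<close> to an open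
      set of characters around \<theta>.\<close>
    then have "openin (subtopology character_space ?D) {\<phi> \<in> ?D. germ s \<phi> \<in> W'}"
      using openin_continuous_map_preimage[OF continuous_map_germ W'(1), of s] by simp
    then have open_pre: "openin character_space {\<phi> \<in> ?D. germ s \<phi> \<in> W'}"
      using openin_trans_full openin_char_dom[OF star_mult_idempotent] by blast
    have mem_pre: "\<theta> \<in> {\<phi> \<in> ?D. germ s \<phi> \<in> W'}"
      using s \<gamma> W'(2) by simp
    \<comment> \<open>Although \<theta> may be 0 at \<open>e\<close>, all characters that are 1 at
      \<open>e\<close> have their germ of \<open>s\<close> in \<open>W'\<close>, and singularity of
      \<open>a\<close> can be used at \<open>e\<close> since \<open>e \<noteq> 0\<close>.\<close>
    obtain e where e: "e \<in> idempotents" "e \<noteq> 0" "char_dom e \<subseteq> {\<phi> \<in> ?D. germ s \<phi> \<in> W'}"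
      by (rule idempotent_basis_tight[OF open_pre mem_pre \<theta>(1) star_mult_idempotent \<theta>(2)])
    obtain f where f: "f \<in> idempotents" "f \<noteq> 0" "nat_le f e"
      "contracted_mult a (contracted_of f) = (\<lambda>_. 0)"
      using a e(1,2) unfolding singular_ideal_def by blast
    \<comment> \<open>Tightness of \<phi> places [s, \<phi>] in \<open>W\<close> and not only in
      \<open>W'\<close>.\<close>
    obtain \<phi> where \<phi>: "\<phi> \<in> tight_characters" "\<phi> f"
      using tight_character_exists[OF f(1,2)] by blast
    then have \<phi>_char: "\<phi> \<in> characters"
      by (simp add: tight_characters_def)
    then have "\<phi> \<in> char_dom e"
      using character_mono[OF \<phi>_char f(1) e(1) f(3) \<phi>(2)] by (simp add: char_dom_def)
    then have D: "\<phi> \<in> ?D" "germ s \<phi> \<in> W'"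
      using e(3) by auto
    then have "germ s \<phi> \<in> W"
      using W'(2) \<phi>(1) by (simp add: gdom_germ gran_germ act_tight_character)
    moreover have "Psi a (germ s \<phi>) = 0"
      using Psi_contracted_mult_idempotent[OF ac D(1) f(1) \<phi>(2)] f(4) by (simp add: Psi_def)
    ultimately show False
      using W(2) by blast
  qed
  moreover have "\<forall>\<gamma>\<in>(arrows tight_groupoid) interior_of {\<gamma> \<in> topspace (arrows tight_groupoid). Psi a \<gamma> \<noteq> 0}.
      Psi a \<gamma> \<noteq> 0"
    using interior_of_subset[of "arrows tight_groupoid"
        "{\<gamma> \<in> topspace (arrows tight_groupoid). Psi a \<gamma> \<noteq> 0}"] by blast
  ultimately have
    "(arrows tight_groupoid) interior_of {\<gamma> \<in> topspace (arrows tight_groupoid). Psi a \<gamma> \<noteq> 0} = {}"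
    using openin_interior_of by blast
  then show ?thesis
    using Psi_steinberg_algebra[OF ac] by (simp add: singular_functions_def)
qed

text \<open>Among the nonzero idempotents \<open>f \<le> e\<close> choose one for which the number of distinct nonzero
  products \<open>t f\<close>, with \<open>t\<close> in the support of \<open>a\<close>, is minimal. Distinct such products then stay
  distinct below \<open>f\<close>, so on the germs of one of them \<open>Psi a\<close> is constantly its coefficient in
  \<open>a f\<close>.\<close>

lemma singular_of_Psi_singular:
  fixes a :: "'s::inverse_semigroup_zero \<Rightarrow> 'k::{comm_ring, comm_monoid_mult}"
  assumes a: "a \<in> contracted_algebra" and sing: "Psi a \<in> singular_functions tight_groupoid"
    and e: "e \<in> idempotents" "e \<noteq> 0"
  shows "\<exists>f\<in>idempotents. f \<noteq> 0 \<and> nat_le f e \<and> contracted_mult a (contracted_of f) = (\<lambda>_. 0)"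
proof -
  define A where "A = {t. a t \<noteq> 0}"
  have A: "finite A"
    using a by (simp add: contracted_algebra_def A_def)
  define B where "B f = (\<lambda>t. t * f) ` A - {0}" for f
  have B: "finite (B f)" for f
    using A by (simp add: B_def)
  have "\<exists>f. (f \<in> idempotents \<and> f \<noteq> 0 \<and> nat_le f e) \<and>
      (\<forall>g. g \<in> idempotents \<and> g \<noteq> 0 \<and> nat_le g e \<longrightarrow> card (B f) \<le> card (B g))"
    by (rule ex_has_least_nat) (use e nat_le_refl in blast)
  then obtain f where f: "f \<in> idempotents" "f \<noteq> 0" "nat_le f e"
    and min: "\<And>g. g \<in> idempotents \<Longrightarrow> g \<noteq> 0 \<Longrightarrow> nat_le g e \<Longrightarrow> card (B f) \<le> card (B g)"
    by blast
  have inj: "inj_on (\<lambda>u. u * g) (B f)" if g: "g \<in> idempotents" "g \<noteq> 0" "nat_le g f" for g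
  proof -
    have fg: "f * g = g"
      using g by (simp add: nat_le_idempotent_iff)
    \<comment> \<open>Each \<open>t * g\<close> equals \<open>(t * f) * g\<close>. Hence
      \<open>card (B g)\<close> is at most the size of the image of \<open>B f\<close>, which is at
      most \<open>card (B f)\<close>; minimality forces equality and so injectivity.\<close>
    have "B g \<subseteq> (\<lambda>u. u * g) ` B f"
    proof
      fix v assume "v \<in> B g"
      then obtain t where t: "t \<in> A" "v = t * g" "v \<noteq> 0"
        by (auto simp: B_def)
      then have "v = (t * f) * g"
        using fg by (simp add: mult.assoc)
      moreover from this t(3) have "t * f \<noteq> 0"
        by auto
      ultimately show "v \<in> (\<lambda>u. u * g) ` B f"
        using t(1) by (auto simp: B_def)
    qed
    then have "card (B g) \<le> card ((\<lambda>u. u * g) ` B f)"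
      using B by (intro card_mono) auto
    moreover have "card (B f) \<le> card (B g)"
      using min[OF g(1,2)] idempotent_nat_le_trans[OF g(1) f(1) g(3) f(3)] by blast
    ultimately show ?thesis
      using card_image_le[OF B, of "\<lambda>u. u * g" f] by (intro eq_card_imp_inj_on B) simp
  qed
  let ?b = "contracted_mult a (contracted_of f)"
  have "?b u = 0" for u
  proof (rule ccontr)
    assume bu: "?b u \<noteq> 0"
    then have u: "u \<in> B f"
      using contracted_mult_idempotent_support[OF f(2), of a] by (auto simp: B_def A_def)
    then obtain t where t: "u = t * f" "u \<noteq> 0"
      by (auto simp: B_def)
    \<comment> \<open>Being below \<open>f\<close>, this idempotent ensures that every character in
      the domain of \<open>u\<close> is 1 at \<open>f\<close>, and that \<open>inj\<close> applies
      to the idempotents below it.\<close>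
    have uf: "star u * u \<in> idempotents" "star u * u \<noteq> 0" "nat_le (star u * u) f"
    proof -
      show "star u * u \<in> idempotents"
        by (rule star_mult_idempotent)
      show "star u * u \<noteq> 0"
        using t(2) mult_star_mult[of u] by (metis mult.assoc mult_zero_right)
      have "star u * u = f * (star t * t)"
        unfolding t(1) star_mult_mult_idempotent[OF f(1)]
        by (rule idempotent_commute[OF star_mult_idempotent f(1)])
      then show "nat_le (star u * u) f"
        using nat_le_mult_idempotent[OF star_mult_idempotent, of f t] by simp
    qed
    have "Psi a \<gamma> \<noteq> 0" if mem: "\<gamma> \<in> tight_germs u" for \<gamma>
    proof -
      obtain \<theta> where \<gamma>: "\<gamma> = germ u \<theta>" "\<theta> \<in> char_dom (star u * u)"
        using mem by (auto simp: germ_set_def)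
      have \<theta>: "\<theta> \<in> characters" "\<theta> (star u * u)"
        using \<gamma>(2) by (simp_all add: char_dom_def)
      have \<theta>f: "\<theta> f"
        using character_mono[OF \<theta>(1) uf(1) f(1) uf(3) \<theta>(2)] .
      have other: "char_fun (tight_germs v) \<gamma> = (0 :: 'k)" if v: "v \<in> B f" "v \<noteq> u" for v
      proof -
        have False if vmem: "\<gamma> \<in> tight_germs v"
        proof -
          \<comment> \<open>A common germ of \<open>u\<close> and \<open>v\<close> gives a nonzero
            idempotent \<open>star w * w\<close> below \<open>f\<close> with
            \<open>u * (star w * w) = w = v * (star w * w)\<close>, against injectivity.\<close>
          obtain w where w: "nat_le w u" "nat_le w v" "\<theta> \<in> char_dom (star w * w)"
            using vmem germ_mem_germ_set_iff[OF \<gamma>(2), of "tight_dom v" v] \<gamma>(1) by auto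
          let ?g = "star w * w"
          have "?g \<noteq> 0"
            using w(3) character_zero[OF \<theta>(1)] by (auto simp: char_dom_def)
          moreover have "nat_le ?g (star u * u)"
            using nat_le_domain[OF w(1)] by (simp add: nat_le_idempotent_iff star_mult_idempotent)
          then have "nat_le ?g f"
            using idempotent_nat_le_trans[OF star_mult_idempotent uf(1) _ uf(3)] by blast
          ultimately have "inj_on (\<lambda>u. u * ?g) (B f)"
            using inj[OF star_mult_idempotent] by blast
          moreover have "u * ?g = v * ?g"
            using nat_le_eq[OF w(1)] nat_le_eq[OF w(2)] by simp
          ultimately show False
            using u v by (auto dest: inj_onD)
        qed
        then show ?thesis
          by (auto simp: char_fun_def)
      qed
      have "Psi a \<gamma> = Psi ?b \<gamma>"
        unfolding \<gamma>(1) by (rule Psi_contracted_mult_idempotent[OF a \<gamma>(2) f(1) \<theta>f, symmetric])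
      also have "\<dots> = (\<Sum>v\<in>B f. ?b v * char_fun (tight_germs v) \<gamma>)"
        using contracted_mult_idempotent_support[OF f(2), of a]
        by (intro Psi_superset B) (simp add: B_def A_def)
      also have "\<dots> = ?b u * char_fun (tight_germs u) \<gamma>"
        using other by (subst sum.remove[OF B u]) simp
      also have "\<dots> = ?b u"
        using mem by (simp add: char_fun_def)
      finally show ?thesis
        using bu by simp
    qed
    moreover have "tight_germs u \<subseteq> topspace (arrows tight_groupoid)"
      by (rule openin_subset[OF openin_germ_set_tight_dom])
    ultimately have "tight_germs u \<subseteq>
        (arrows tight_groupoid) interior_of {\<gamma> \<in> topspace (arrows tight_groupoid). Psi a \<gamma> \<noteq> 0}"
      by (intro interior_of_maximal openin_germ_set_tight_dom) auto
    \<comment> \<open>Singularity of \<open>Psi a\<close> leaves no room for this open set, yet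
      \<open>star u * u \<noteq> 0\<close> admits a tight character and hence a germ.\<close>
    then have "tight_germs u = {}"
      using sing by (simp add: singular_functions_def)
    moreover obtain \<theta> where "\<theta> \<in> tight_characters" "\<theta> (star u * u)"
      using tight_character_exists[OF uf(1,2)] by blast
    then have "germ u \<theta> \<in> tight_germs u"
      by (auto simp: germ_set_def char_dom_def tight_characters_def)
    ultimately show False
      by blast
  qed
  then show ?thesis
    using f by blast
qed

text \<open>\<open>Psi\<close> is a function on all coordinate functions, so its preimage is
  intersected with the contracted algebra.\<close>

theorem proposition4p9:
  "(singular_ideal :: ('s::inverse_semigroup_zero \<Rightarrow> 'k::{comm_ring, comm_monoid_mult}) set) =
     Psi -` singular_functions tight_groupoid \<inter> contracted_algebra"
proof (intro equalityI subsetI)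
  fix a :: "'s \<Rightarrow> 'k" assume "a \<in> singular_ideal"
  then show "a \<in> Psi -` singular_functions tight_groupoid \<inter> contracted_algebra"
    using Psi_singular by (auto simp: singular_ideal_def)
next
  fix a :: "'s \<Rightarrow> 'k" assume "a \<in> Psi -` singular_functions tight_groupoid \<inter> contracted_algebra"
  then show "a \<in> singular_ideal"
    using singular_of_Psi_singular by (auto simp: singular_ideal_def)
qed

end
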